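(* Let $K$ be a field of characteristic $0$ and let $p \in K[x,y]$ be a non-constant polynomial such that $K[p]$ is a retract of $K[x,y]$. Then there are a $K$-algebra automorphism $\psi$ of $K[x,y]$ and a polynomial $q = q(x,y) \in K[x,y]$ such that $\psi(p) = x + y\cdot q$. Moreover, the $K$-algebra endomorphism of $K[x,y]$ given by $x \mapsto x + y\cdot q$, $y \mapsto 0$ is a retraction for $K[\psi(p)]$ (that is, it is idempotent with image $K[\psi(p)]$).
   Context: A $K$-subalgebra $R$ of $K[x,y]$ is called a retract if there is an idempotent $K$-algebra homomorphism (a retraction) $\varphi: K[x,y] \to K[x,y]$, i.e. $\varphi\circ\varphi=\varphi$, such that $\varphi(K[x,y]) = R$. For $p\in K[x,y]$, $K[p]$ denotes the $K$-subalgebra generated by $p$. *)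

theory Defs
  imports "HOL-Computational_Algebra.Polynomial"
begin

text \<open>
  The ring \<open>K[x,y]\<close> is represented as \<open>K[x][y]\<close>, i.e. by the type \<open>'k poly poly\<close>: the inner
  indeterminate is \<open>x\<close>, the outer one is \<open>y\<close>, and \<open>K\<close> embeds by \<open>c \<mapsto> [:[:c:]:]\<close>.
\<close>

definition scalar :: "'k::field \<Rightarrow> 'k poly poly" where
  "scalar c = [:[:c:]:]"

definition var_x :: "'k::field poly poly" where
  "var_x = [:[:0, 1:]:]"

definition var_y :: "'k::field poly poly" where
  "var_y = [:0, 1:]"

text \<open>Preservation of \<open>1\<close> and \<open>K\<close>-linearity are the fixing of scalars together with multiplicativity.\<close>

definition alg_hom :: "('k::field poly poly \<Rightarrow> 'k poly poly) \<Rightarrow> bool" where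
  "alg_hom \<phi> \<longleftrightarrow>
     (\<forall>c. \<phi> (scalar c) = scalar c) \<and>
     (\<forall>f g. \<phi> (f + g) = \<phi> f + \<phi> g) \<and>
     (\<forall>f g. \<phi> (f * g) = \<phi> f * \<phi> g)"

definition alg_aut :: "('k::field poly poly \<Rightarrow> 'k poly poly) \<Rightarrow> bool" where
  "alg_aut \<psi> \<longleftrightarrow> alg_hom \<psi> \<and> bij \<psi>"

definition kxy_subalgebra :: "'k::field poly poly set \<Rightarrow> bool" where
  "kxy_subalgebra R \<longleftrightarrow>
     (\<forall>c. scalar c \<in> R) \<and>
     (\<forall>f\<in>R. \<forall>g\<in>R. f + g \<in> R) \<and>
     (\<forall>f\<in>R. \<forall>g\<in>R. f * g \<in> R)"

definition gen_alg :: "'k::field poly poly \<Rightarrow> 'k poly poly set" where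
  "gen_alg p = kxy_subalgebra hull {p}"

definition kxy_retraction :: "('k::field poly poly \<Rightarrow> 'k poly poly) \<Rightarrow> 'k poly poly set \<Rightarrow> bool" where
  "kxy_retraction \<phi> R \<longleftrightarrow> alg_hom \<phi> \<and> \<phi> \<circ> \<phi> = \<phi> \<and> range \<phi> = R"

definition kxy_retract :: "'k::field poly poly set \<Rightarrow> bool" where
  "kxy_retract R \<longleftrightarrow> kxy_subalgebra R \<and> (\<exists>\<phi>. kxy_retraction \<phi> R)"

text \<open>
  \<open>xy_subst a b f = f(a,b)\<close>. The lemmas below identify \<open>xy_subst a b\<close> as the unique \<open>K\<close>-algebra
  endomorphism with \<open>x \<mapsto> a\<close> and \<open>y \<mapsto> b\<close>.
\<close>

definition xy_subst :: "'k::field poly poly \<Rightarrow> 'k poly poly \<Rightarrow> 'k poly poly \<Rightarrow> 'k poly poly" where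
  "xy_subst a b f = poly (map_poly (\<lambda>c. poly (map_poly scalar c) a) f) b"

lemma poly_map_poly_pCons:
  assumes "h 0 = 0"
  shows "poly (map_poly h (pCons c f)) a = h c + a * poly (map_poly h f) a"
  using assms by (cases "c = 0 \<and> f = 0") (auto simp: map_poly_pCons)

lemma poly_map_poly_add:
  assumes h0: "h 0 = 0" and hadd: "\<And>c d. h (c + d) = h c + h d"
  shows "poly (map_poly h (f + g)) a = poly (map_poly h f) a + poly (map_poly h g) a"
proof (induction f g rule: poly_induct2)
  case 0
  then show ?case by simp
next
  case (pCons c f d g)
  then show ?case
    by (simp add: poly_map_poly_pCons h0 hadd algebra_simps)
qed

lemma poly_map_poly_smult:
  assumes h0: "h 0 = 0" and hmult: "\<And>c d. h (c * d) = h c * h d"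
  shows "poly (map_poly h (smult c f)) a = h c * poly (map_poly h f) a"
  by (induction f) (simp_all add: poly_map_poly_pCons h0 hmult algebra_simps)

lemma poly_map_poly_mult:
  assumes h0: "h 0 = 0" and hadd: "\<And>c d. h (c + d) = h c + h d"
    and hmult: "\<And>c d. h (c * d) = h c * h d"
  shows "poly (map_poly h (f * g)) a = poly (map_poly h f) a * poly (map_poly h g) a"
  by (induction f)
    (simp_all add: poly_map_poly_pCons poly_map_poly_add poly_map_poly_smult h0 hadd hmult
      algebra_simps)

lemma scalar_simps:
  "scalar 0 = 0" "scalar 1 = 1" "scalar (c + d) = scalar c + scalar d"
  "scalar (c * d) = scalar c * scalar d"
  by (simp_all add: scalar_def one_pCons)

lemma alg_hom_xy_subst: "alg_hom (xy_subst a b)"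
proof -
  define h where "h = (\<lambda>c. poly (map_poly scalar c) a)"
  have h0: "h 0 = 0" by (simp add: h_def)
  have hadd: "h (c + d) = h c + h d" for c d
    unfolding h_def by (rule poly_map_poly_add) (simp_all add: scalar_simps)
  have hmult: "h (c * d) = h c * h d" for c d
    unfolding h_def by (rule poly_map_poly_mult) (simp_all add: scalar_simps)
  have hscalar: "h [:c:] = scalar c" for c
    by (simp add: h_def poly_map_poly_pCons scalar_simps)
  have subst: "xy_subst a b f = poly (map_poly h f) b" for f
    by (simp add: xy_subst_def h_def)
  have "xy_subst a b (scalar c) = scalar c" for c
    by (simp add: subst scalar_def[of c] poly_map_poly_pCons h0 hscalar)
  moreover have "xy_subst a b (f + g) = xy_subst a b f + xy_subst a b g" for f g
    unfolding subst by (rule poly_map_poly_add) (simp_all add: h0 hadd)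
  moreover have "xy_subst a b (f * g) = xy_subst a b f * xy_subst a b g" for f g
    unfolding subst by (rule poly_map_poly_mult) (simp_all add: h0 hadd hmult)
  ultimately show ?thesis by (simp add: alg_hom_def)
qed

lemma xy_subst_X: "xy_subst a b var_x = a"
  by (simp add: xy_subst_def var_x_def poly_map_poly_pCons scalar_simps)

lemma xy_subst_Y: "xy_subst a b var_y = b"
  by (simp add: xy_subst_def var_y_def poly_map_poly_pCons scalar_simps one_pCons[symmetric])

lemma alg_hom_unique:
  assumes "alg_hom \<phi>" "\<phi> var_x = a" "\<phi> var_y = b"
  shows "\<phi> = xy_subst a b"
proof
  fix f
  have eq: "\<phi> g = xy_subst a b g" if "g = [:c:]" for g c
    using that
  proof (induction c arbitrary: g)
    case 0
    have "g = scalar 0" using 0 by (simp add: scalar_def)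
    then show ?case using assms alg_hom_xy_subst[of a b] by (metis alg_hom_def)
  next
    case (pCons k c)
    have "g = scalar k + var_x * [:c:]"
      using pCons by (simp add: scalar_def var_x_def)
    then show ?case using assms alg_hom_xy_subst[of a b] pCons.IH[of "[:c:]"] xy_subst_X[of a b]
      unfolding alg_hom_def by metis
  qed
  show "\<phi> f = xy_subst a b f"
  proof (induction f)
    case 0
    show ?case using eq[of 0 0] by simp
  next
    case (pCons c f)
    have "pCons c f = [:c:] + var_y * f" by (simp add: var_y_def)
    then show ?case using assms alg_hom_xy_subst[of a b] pCons.IH eq[of "[:c:]" c] xy_subst_Y[of a b]
      unfolding alg_hom_def by metis
  qed
qed

end

theory Submission
  imports Defs "HOL-Algebra.Algebraic_Closure_Type"
    "HOL-Computational_Algebra.Formal_Laurent_Series" "HOL-Computational_Algebra.Polynomial_FPS"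
begin

text \<open>
  A retraction onto \<open>K[p]\<close> sends \<open>x, y\<close> to \<open>a(p), b(p)\<close> with \<open>p(a(t), b(t)) = t\<close>, so \<open>(a, b)\<close> is an
  embedded line. By the Abhyankar--Moh theorem one of the degrees of \<open>a\<close> and \<open>b\<close> divides the other,
  so elementary automorphisms straighten the line to \<open>(t, 0)\<close>; they turn \<open>p\<close> into a polynomial with
  \<open>p(t, 0) = t\<close>.

  For the Abhyankar--Moh theorem let \<open>f, g\<close> of degrees \<open>n, m\<close> generate \<open>k[t]\<close>, \<open>k\<close> algebraically closed.
  Write \<open>t = \<theta>(\<tau>)\<close> with \<open>f(\<theta>) = \<tau>\<^sup>-\<^sup>n\<close> and let \<open>\<gamma> = g(\<theta>)\<close>. The equation of the curve is
  \<open>F = \<Prod>(Y - \<gamma>(w\<tau>))\<close> over the \<open>n\<close>-th roots of unity \<open>w\<close>. Since the curve is smooth,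
  \<open>\<partial>F/\<partial>Y\<close> divides \<open>f'\<close>, which gives \<open>\<Sum> deg(\<gamma>(\<tau>) - \<gamma>(w\<tau>)) \<le> n - 1\<close> over \<open>w \<noteq> 1\<close>. In the other
  direction, for the characteristic divisors \<open>d\<close> of \<open>n\<close>, the approximate \<open>d\<close>-th root of \<open>F\<close> takes at
  \<open>(f, g)\<close> a polynomial value, whose degree is therefore nonnegative. This bounds the contributions
  of the roots of unity of order dividing \<open>d\<close>, and by induction \<open>(n - d) m \<le> d (n - 1)\<close> for
  \<open>d = gcd n m\<close>, which forces \<open>d = n\<close> or \<open>d = m\<close>.
\<close>

hide_const (open) module.smult Polynomials.lead_coeff Polynomials.degree up_ring.coeff up_ring.monom
  Coset.order

section \<open>Ring homomorphisms, subrings and polynomials\<close>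

locale ring_map =
  fixes h :: "'a::comm_ring_1 \<Rightarrow> 'b::comm_ring_1"
  assumes map_0 [simp]: "h 0 = 0" and map_1 [simp]: "h 1 = 1"
    and map_add [simp]: "h (x + y) = h x + h y"
    and map_mult [simp]: "h (x * y) = h x * h y"
begin

lemma map_uminus [simp]: "h (- x) = - h x"
  by (metis map_0 map_add add_eq_0_iff)

lemma map_diff [simp]: "h (x - y) = h x - h y"
  using map_add[of x "- y"] by simp

lemma map_sum: "h (\<Sum>i\<in>A. x i) = (\<Sum>i\<in>A. h (x i))"
  by (induction A rule: infinite_finite_induct) auto

lemma map_prod: "h (\<Prod>i\<in>A. x i) = (\<Prod>i\<in>A. h (x i))"
  by (induction A rule: infinite_finite_induct) auto

lemma map_power [simp]: "h (x ^ n) = h x ^ n"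
  by (induction n) auto

lemma map_poly_pCons' [simp]: "map_poly h (pCons c p) = pCons (h c) (map_poly h p)"
  by (rule map_poly_pCons) simp

lemma coeff_map_poly' [simp]: "coeff (map_poly h p) n = h (coeff p n)"
  by (rule coeff_map_poly) simp

lemma ring_map_map_poly: "ring_map (map_poly h)"
  by unfold_locales (auto intro!: poly_eqI simp: coeff_mult map_sum one_pCons)

lemma poly_map_poly [simp]: "poly (map_poly h p) (h x) = h (poly p x)"
  by (induction p) auto

lemma ring_map_poly_map_poly: "ring_map (\<lambda>p. poly (map_poly h p) a)"
proof -
  interpret P: ring_map "map_poly h" by (rule ring_map_map_poly)
  show ?thesis by unfold_locales auto
qed

lemma map_poly_pcompose: "map_poly h (pcompose p q) = pcompose (map_poly h p) (map_poly h q)"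
proof -
  interpret P: ring_map "map_poly h" by (rule ring_map_map_poly)
  show ?thesis by (induction p) (auto simp: pcompose_pCons)
qed

end

lemma ring_map_poly: "ring_map (\<lambda>p. poly p (a :: 'a::comm_ring_1))"
  by unfold_locales auto

locale subring_set =
  fixes C :: "'a::comm_ring_1 set"
  assumes one_in [simp, intro]: "1 \<in> C"
    and diff_in [intro]: "x \<in> C \<Longrightarrow> y \<in> C \<Longrightarrow> x - y \<in> C"
    and mult_in [intro]: "x \<in> C \<Longrightarrow> y \<in> C \<Longrightarrow> x * y \<in> C"
begin

lemma zero_in [simp, intro]: "0 \<in> C"
  using diff_in[OF one_in one_in] by simp

lemma uminus_in [intro]: "x \<in> C \<Longrightarrow> - x \<in> C"
  using diff_in[OF zero_in] by fastforce

lemma add_in [intro]: "x \<in> C \<Longrightarrow> y \<in> C \<Longrightarrow> x + y \<in> C"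
  using diff_in[of x "- y"] uminus_in by fastforce

lemma sum_in [intro]: "(\<And>i. i \<in> I \<Longrightarrow> f i \<in> C) \<Longrightarrow> sum f I \<in> C"
  by (induction I rule: infinite_finite_induct) auto

lemma prod_in [intro]: "(\<And>i. i \<in> I \<Longrightarrow> f i \<in> C) \<Longrightarrow> prod f I \<in> C"
  by (induction I rule: infinite_finite_induct) auto

lemma power_in [intro]: "x \<in> C \<Longrightarrow> x ^ n \<in> C"
  by (induction n) auto

end

definition polys_in :: "'a::zero set \<Rightarrow> 'a poly set" where
  "polys_in C = {p. \<forall>i. coeff p i \<in> C}"

lemma polys_in_mono: "C \<subseteq> D \<Longrightarrow> polys_in C \<subseteq> polys_in D"
  by (auto simp: polys_in_def)

context subring_set
begin

lemma pCons_in [simp]: "pCons c p \<in> polys_in C \<longleftrightarrow> c \<in> C \<and> p \<in> polys_in C"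
  by (auto simp: polys_in_def coeff_pCons split: nat.splits)

lemma zero_poly_in [simp]: "0 \<in> polys_in C"
  by (auto simp: polys_in_def)

lemma subring_polys_in: "subring_set (polys_in C)"
  by unfold_locales (auto simp: polys_in_def coeff_mult one_pCons coeff_pCons split: nat.splits)

lemma smult_in [intro]: "c \<in> C \<Longrightarrow> p \<in> polys_in C \<Longrightarrow> smult c p \<in> polys_in C"
  by (auto simp: polys_in_def)

lemma monom_in [intro]: "c \<in> C \<Longrightarrow> monom c n \<in> polys_in C"
  by (auto simp: polys_in_def)

lemma poly_in [intro]: "p \<in> polys_in C \<Longrightarrow> x \<in> C \<Longrightarrow> poly p x \<in> C"
  by (induction p) auto

lemma pcompose_in [intro]: "p \<in> polys_in C \<Longrightarrow> q \<in> polys_in C \<Longrightarrow> pcompose p q \<in> polys_in C"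
proof (induction p)
  case (pCons a p)
  interpret P: subring_set "polys_in C" by (rule subring_polys_in)
  show ?case using pCons by (auto simp: pcompose_pCons)
qed auto

text \<open>Cancelling a leading term against a monic \<open>G\<close> never inverts a coefficient,
  so long division stays inside the subring.\<close>

lemma monic_division_in:
  assumes G: "G \<in> polys_in C" "lead_coeff G = 1" and B: "B \<in> polys_in C"
  shows "\<exists>Q\<in>polys_in C. \<exists>R\<in>polys_in C. B = Q * G + R \<and> (R = 0 \<or> degree R < degree G)"
  using B
proof (induction "degree B" arbitrary: B rule: less_induct)
  case less
  interpret P: subring_set "polys_in C" by (rule subring_polys_in)
  show ?case
  proof (cases "B = 0 \<or> degree B < degree G")
    case True
    then show ?thesis using less.prems by (intro bexI[of _ 0] bexI[of _ B]) auto
  next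
    case False
    define c where "c = lead_coeff B"
    define M where "M = monom c (degree B - degree G)"
    have M: "M \<in> polys_in C" using less.prems by (auto simp: M_def c_def polys_in_def)
    have c0: "c \<noteq> 0" using False by (auto simp: c_def)
    have degM: "degree (M * G) \<le> degree B"
      using False degree_mult_le[of M G] degree_monom_le[of c "degree B - degree G"]
      by (auto simp: M_def)
    have coeffM: "coeff (M * G) (degree B) = c"
      using False G(2) by (simp add: M_def coeff_monom_mult)
    define B' where "B' = B - M * G"
    have B': "B' \<in> polys_in C" using less.prems M G by (auto simp: B'_def)
    have cB': "coeff B' (degree B) = 0" by (simp add: B'_def coeffM c_def)
    have dB': "degree B' \<le> degree B" unfolding B'_def using degM by (intro degree_diff_le) auto
    have "\<exists>Q\<in>polys_in C. \<exists>R\<in>polys_in C. B' = Q * G + R \<and> (R = 0 \<or> degree R < degree G)"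
    proof (cases "B' = 0")
      case True
      then show ?thesis by (intro bexI[of _ 0]) auto
    next
      case False
      with cB' dB' have "degree B' < degree B"
        by (metis leading_coeff_0_iff le_neq_implies_less)
      with less.hyps B' show ?thesis by blast
    qed
    then obtain Q R where QR: "Q \<in> polys_in C" "R \<in> polys_in C" "B' = Q * G + R"
      "R = 0 \<or> degree R < degree G" by blast
    then have "B = (Q + M) * G + R" by (simp add: B'_def algebra_simps)
    then show ?thesis using QR M by blast
  qed
qed

end

lemma div_mod_poly_unique:
  fixes Q G R :: "'a::field poly"
  assumes "R = 0 \<or> degree R < degree G" "G \<noteq> 0"
  shows "(Q * G + R) div G = Q" "(Q * G + R) mod G = R"
proof -
  have "R div G = 0" using assms by (auto intro: div_poly_less)
  then show *: "(Q * G + R) div G = Q" using assms by (simp add: add.commute)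
  show "(Q * G + R) mod G = R"
    using div_mult_mod_eq[of "Q * G + R" G] * by simp
qed

text \<open>Uniqueness of division with remainder over the field identifies \<open>div\<close> and
  \<open>mod\<close> with the quotient and remainder computed over \<open>C\<close>.\<close>

lemma monic_div_mod_in:
  fixes G B :: "'a::field poly"
  assumes "subring_set C" and G: "G \<in> polys_in C" "lead_coeff G = 1" and B: "B \<in> polys_in C"
  shows "B div G \<in> polys_in C" "B mod G \<in> polys_in C"
proof -
  from subring_set.monic_division_in[OF assms] obtain Q R
    where "Q\<in>polys_in C" "R\<in>polys_in C" "B = Q * G + R" "R = 0 \<or> degree R < degree G" by blast
  moreover have "G \<noteq> 0" using G by auto
  ultimately show "B div G \<in> polys_in C" "B mod G \<in> polys_in C"
    using div_mod_poly_unique by metis+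
qed

section \<open>Approximate roots\<close>

lemma coeff_mult_degree_bound:
  assumes "degree p \<le> m" "degree q \<le> n"
  shows "coeff (p * q) (m + n) = coeff p m * coeff q n"
proof -
  have "(\<Sum>i\<le>m+n. coeff p i * coeff q (m + n - i)) = (\<Sum>i\<in>{m}. coeff p i * coeff q (m + n - i))"
  proof (rule sum.mono_neutral_right)
    show "\<forall>i\<in>{..m + n} - {m}. coeff p i * coeff q (m + n - i) = 0"
    proof
      fix i assume i: "i \<in> {..m+n} - {m}"
      show "coeff p i * coeff q (m + n - i) = 0"
      proof (cases "i < m")
        case True
        then have "coeff q (m + n - i) = 0" using assms(2) by (intro coeff_eq_0) auto
        then show ?thesis by simp
      next
        case False
        then have "coeff p i = 0" using i assms(1) by (intro coeff_eq_0) auto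
        then show ?thesis by simp
      qed
    qed
  qed auto
  then show ?thesis by (simp add: coeff_mult)
qed

lemma degree_monic_power:
  fixes G :: "'a::idom poly"
  assumes "lead_coeff G = 1"
  shows "degree (G ^ k) = k * degree G" "lead_coeff (G ^ k) = 1"
proof -
  have "G \<noteq> 0" using assms by auto
  then show "degree (G ^ k) = k * degree G" by (rule degree_power_eq)
  show "lead_coeff (G ^ k) = 1" using assms by (simp add: lead_coeff_power)
qed

text \<open>Counting \<open>0\<close> as below every bound, including \<open>n = 0\<close>, makes
  the polynomials below a bound closed under sums and differences.\<close>

definition deg_lt :: "'a::zero poly \<Rightarrow> nat \<Rightarrow> bool" where
  "deg_lt p n \<longleftrightarrow> p = 0 \<or> degree p < n"

lemma deg_lt_iff_coeff: "deg_lt p n \<longleftrightarrow> (\<forall>i\<ge>n. coeff p i = 0)"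
  unfolding deg_lt_def
  by (metis coeff_0 coeff_eq_0 leading_coeff_0_iff linorder_not_le order_less_le_trans)

lemma deg_lt_0 [simp]: "deg_lt 0 n"
  by (simp add: deg_lt_def)

lemma deg_lt_add: "deg_lt p n \<Longrightarrow> deg_lt q n \<Longrightarrow> deg_lt (p + q) n"
  and deg_lt_mono: "deg_lt p n \<Longrightarrow> n \<le> m \<Longrightarrow> deg_lt p m"
  by (auto simp: deg_lt_iff_coeff)

lemma deg_lt_diff: "deg_lt p n \<Longrightarrow> deg_lt q n \<Longrightarrow> deg_lt (p - q) n"
  for p :: "'a::ab_group_add poly"
  by (auto simp: deg_lt_iff_coeff)

lemma deg_lt_mult: "deg_lt p n \<Longrightarrow> degree q \<le> m \<Longrightarrow> deg_lt (p * q) (n + m)"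
  for p :: "'a::idom poly"
  by (cases "p = 0 \<or> q = 0") (auto simp: deg_lt_def degree_mult_eq)

lemma deg_lt_smult: "deg_lt p n \<Longrightarrow> deg_lt (smult c p) n" for p :: "'a::idom poly"
  by (auto simp: deg_lt_iff_coeff)

text \<open>The binomial terms of order at least two in \<open>c\<close> trade a factor
  \<open>G\<close> for a further factor \<open>c\<close> of smaller degree.\<close>

lemma power_add_first_order:
  fixes G c :: "'a::idom poly"
  assumes c: "deg_lt c (degree G)"
  shows "deg_lt ((G + c) ^ Suc d - G ^ Suc d - smult (of_nat (Suc d)) (c * G ^ d)) (d * degree G + degree c)"
proof (induction d)
  case 0
  show ?case by simp
next
  case (Suc d)
  show ?case
  proof (cases "c = 0")
    case False
    then have dc: "degree c < degree G" using c by (auto simp: deg_lt_def)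
    define E where "E = (G + c) ^ Suc d - G ^ Suc d - smult (of_nat (Suc d)) (c * G ^ d)"
    have "(G + c) ^ Suc (Suc d) - G ^ Suc (Suc d) - smult (of_nat (Suc (Suc d))) (c * G ^ Suc d)
        = E * (G + c) + smult (of_nat (Suc d)) (c * c * G ^ d)"
    proof -
      have "smult (of_nat (Suc (Suc d))) x = smult (of_nat (Suc d)) x + x" for x :: "'a poly"
        by (metis of_nat_Suc add.commute smult_1_left smult_add_left)
      then show ?thesis by (simp add: E_def algebra_simps smult_add_right del: of_nat_Suc)
    qed
    moreover have "deg_lt (E * (G + c)) (Suc d * degree G + degree c)"
    proof -
      have "degree (G + c) \<le> degree G" using dc by (simp add: degree_add_le)
      from deg_lt_mult[OF Suc[folded E_def] this] show ?thesis by (simp add: ac_simps)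
    qed
    moreover have "deg_lt (smult (of_nat (Suc d)) (c * c * G ^ d)) (Suc d * degree G + degree c)"
    proof -
      have "degree (c * c * G ^ d) \<le> degree c + degree c + degree (G ^ d)"
        using degree_mult_le[of "c * c" "G ^ d"] degree_mult_le[of c c] by linarith
      then have "deg_lt (c * c * G ^ d) (Suc d * degree G + degree c)"
        using dc degree_power_le[of G d] by (auto simp: deg_lt_def mult.commute)
      then show ?thesis by (rule deg_lt_smult)
    qed
    ultimately show ?thesis using deg_lt_add by simp
  qed (simp add: algebra_simps)
qed

lemma monic_add_deg_lt:
  fixes G c :: "'a::idom poly"
  assumes "lead_coeff G = 1" "degree G = e" "deg_lt c e"
  shows "lead_coeff (G + c) = 1" "degree (G + c) = e"
proof -
  show "degree (G + c) = e"
    using assms degree_add_eq_left[of c G] by (cases "c = 0") (auto simp: deg_lt_def)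
  moreover have "coeff c e = 0" using assms by (simp add: deg_lt_iff_coeff)
  ultimately show "lead_coeff (G + c) = 1" using assms by simp
qed

text \<open>Tschirnhausen's iteration: as long as \<open>F - G\<^sup>d\<close> is too large, the quotient \<open>B + G\<close> of \<open>F\<close>
  by \<open>G\<^sup>d\<^sup>-\<^sup>1\<close> corrects \<open>G\<close> to \<open>G + B / d\<close>.\<close>

lemma approximate_root_induct:
  fixes F G0 :: "'a::field_char_0 poly"
  assumes F: "lead_coeff F = 1" "degree F = Suc d * e" and e: "e > 0"
    and inv: "\<And>G. I G \<Longrightarrow> lead_coeff G = 1 \<and> degree G = e"
    and step: "\<And>G. I G \<Longrightarrow> I (G + smult (1 / of_nat (Suc d)) (F div G ^ d - G))"
    and G0: "I G0"
  shows "\<exists>P. I P \<and> deg_lt (F - P ^ Suc d) (d * e)"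
  using G0
proof (induction "degree (F - G0 ^ Suc d)" arbitrary: G0 rule: less_induct)
  case less
  define G where "G = G0"
  have G: "lead_coeff G = 1" "degree G = e" and IG: "I G" using inv less.prems by (auto simp: G_def)
  show ?case
  proof (cases "deg_lt (F - G ^ Suc d) (d * e)")
    case True
    then show ?thesis using less.prems G_def by blast
  next
    case False
    have Gd: "degree (G ^ d) = d * e" "lead_coeff (G ^ d) = 1" "G ^ d \<noteq> 0"
      using degree_monic_power[OF G(1)] G by auto
    define R where "R = F mod G ^ d"
    define B where "B = F div G ^ d - G"
    have FR: "F = (G + B) * G ^ d + R"
      unfolding R_def B_def using div_mult_mod_eq[of F "G ^ d"] by simp
    have R: "deg_lt R (d * e)"
      using degree_mod_less[of "G ^ d" F] Gd by (auto simp: deg_lt_def R_def)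
    have diff: "F - G ^ Suc d = B * G ^ d + R" by (simp add: FR algebra_simps)
    have B0: "B \<noteq> 0" using False R diff by auto
    have "degree (F - G ^ Suc d) = d * e + degree B"
    proof -
      have "degree (B * G ^ d) = degree B + d * e" using B0 Gd by (simp add: degree_mult_eq)
      then show ?thesis using R unfolding diff
        by (cases "R = 0") (auto simp: deg_lt_def degree_add_eq_left)
    qed
    note dF = this
    have "deg_lt B e"
    proof -
      have "deg_lt (F - G ^ Suc d) (Suc d * e)"
        unfolding deg_lt_iff_coeff
      proof (intro allI impI)
        fix i assume i: "Suc d * e \<le> i"
        have G': "degree (G ^ Suc d) = Suc d * e" "lead_coeff (G ^ Suc d) = 1"
          using degree_monic_power[OF G(1)] G by blast+
        show "coeff (F - G ^ Suc d) i = 0"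
          using F G' i coeff_eq_0[of F i] coeff_eq_0[of "G ^ Suc d" i]
          by (cases "i = Suc d * e") (auto simp del: power_Suc)
      qed
      then show ?thesis using dF e by (auto simp: deg_lt_def)
    qed
    define c where "c = smult (1 / of_nat (Suc d)) B"
    have dc: "degree c = degree B" by (simp add: c_def del: of_nat_Suc)
    have c: "deg_lt c (degree G)" using \<open>deg_lt B e\<close> G by (simp add: c_def deg_lt_smult)
    have Bc: "B = smult (of_nat (Suc d)) c"
      by (simp add: c_def del: of_nat_Suc)
    have IG': "I (G + c)" using step[OF IG] by (simp add: c_def B_def)
    \<comment> \<open>The factor \<open>1 / (d + 1)\<close> in \<open>c\<close> makes the
      first-order term of \<open>(G + c) ^ (d + 1)\<close> cancel \<open>B * G ^ d\<close>. Only
      \<open>R\<close> and terms of higher order in \<open>c\<close> are left, so the degree of the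
      error drops below \<open>d * e + degree B\<close>.\<close>
    have "F - (G + c) ^ Suc d = R - ((G + c) ^ Suc d - G ^ Suc d - smult (of_nat (Suc d)) (c * G ^ d))"
      using diff unfolding Bc by (simp add: algebra_simps del: power_Suc of_nat_Suc)
    moreover have "deg_lt \<dots> (d * e + degree B)"
    proof (rule deg_lt_diff)
      show "deg_lt R (d * e + degree B)" using R by (rule deg_lt_mono) simp
    qed (use power_add_first_order[OF c, of d] dc G in metis)
    ultimately have small: "deg_lt (F - (G + c) ^ Suc d) (d * e + degree B)" by (simp only:)
    show ?thesis
    proof (cases "F - (G + c) ^ Suc d = 0")
      case True
      then show ?thesis using IG' by (metis deg_lt_0)
    next
      case False
      then have "degree (F - (G + c) ^ Suc d) < degree (F - G0 ^ Suc d)"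
        using small dF by (auto simp: deg_lt_def G_def)
      with less.hyps IG' show ?thesis by blast
    qed
  qed
qed

text \<open>The two powers differ by \<open>(P - P') * T\<close>, where \<open>T\<close> has the
  coefficient \<open>d + 1\<close> at degree \<open>d * e\<close>, which is nonzero in
  characteristic 0. If \<open>P - P'\<close> were nonzero, the product would have degree at least
  \<open>d * e\<close>, although both powers agree with \<open>F\<close> from that degree
  on.\<close>

lemma approximate_root_unique:
  fixes F P P' :: "'a::field_char_0 poly"
  assumes P: "lead_coeff P = 1" "degree P = e" "deg_lt (F - P ^ Suc d) (d * e)"
    and P': "lead_coeff P' = 1" "degree P' = e" "deg_lt (F - P' ^ Suc d) (d * e)"
  shows "P = P'"
proof (rule ccontr)
  assume neq: "P \<noteq> P'"
  define T where "T = (\<Sum>i<Suc d. P' ^ (Suc d - Suc i) * P ^ i)"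
  have eq: "P ^ Suc d - P' ^ Suc d = (P - P') * T"
    unfolding T_def by (rule power_diff_sumr2)
  have "coeff T (d * e) = (\<Sum>i<Suc d. 1)"
    unfolding T_def coeff_sum
  proof (rule sum.cong[OF refl])
    fix i assume i: "i \<in> {..<Suc d}"
    then have "d * e = (Suc d - Suc i) * e + i * e"
      by (simp flip: add_mult_distrib)
    moreover have "coeff (P' ^ (Suc d - Suc i) * P ^ i) ((Suc d - Suc i) * e + i * e) = 1"
      using degree_monic_power[OF P(1)] degree_monic_power[OF P'(1)] P P'
      by (subst coeff_mult_degree_bound) (auto simp: lead_coeff_power)
    ultimately show "coeff (P' ^ (Suc d - Suc i) * P ^ i) (d * e) = 1" by simp
  qed
  also have "\<dots> = of_nat (Suc d)" by simp
  finally have "coeff T (d * e) \<noteq> 0" by (simp del: of_nat_Suc)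
  then have "T \<noteq> 0" "degree T \<ge> d * e" by (auto intro: le_degree)
  then have "\<not> deg_lt ((P - P') * T) (d * e)" using neq by (auto simp: deg_lt_def degree_mult_eq)
  moreover have "deg_lt (P ^ Suc d - P' ^ Suc d) (d * e)"
    using deg_lt_diff[OF P'(3) P(3)] by simp
  ultimately show False using eq by simp
qed

text \<open>The remainder has degree below \<open>d * e\<close>, so \<open>F\<close> and the
  quotient times \<open>G ^ d\<close> have the same leading term.\<close>

lemma degree_div_monic_power:
  fixes F G :: "'a::field poly"
  assumes F: "lead_coeff F = 1" "degree F = Suc d * e" and G: "lead_coeff G = 1" "degree G = e"
    and e: "e > 0"
  shows "lead_coeff (F div G ^ d) = 1" "degree (F div G ^ d) = e" "deg_lt (F div G ^ d - G) e"
proof -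
  have Gd: "degree (G ^ d) = d * e" "lead_coeff (G ^ d) = 1" "G ^ d \<noteq> 0"
    using degree_monic_power[OF G(1)] G by auto
  define Q R where "Q = F div G ^ d" and "R = F mod G ^ d"
  have FR: "F = Q * G ^ d + R" unfolding Q_def R_def by (rule div_mult_mod_eq[symmetric])
  have R: "deg_lt R (d * e)"
    using degree_mod_less[of "G ^ d" F] Gd by (auto simp: deg_lt_def R_def)
  have co: "coeff (Q * G ^ d) i = coeff F i" if "i \<ge> Suc d * e" for i
    using R that unfolding FR deg_lt_iff_coeff by auto
  have c1: "coeff (Q * G ^ d) (Suc d * e) = 1" using co F by simp
  have "degree (Q * G ^ d) = Suc d * e"
  proof (rule antisym)
    show "Suc d * e \<le> degree (Q * G ^ d)" using c1 by (intro le_degree) simp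
    show "degree (Q * G ^ d) \<le> Suc d * e"
      using co coeff_eq_0[of F] F by (intro degree_le) auto
  qed
  moreover from c1 have "Q \<noteq> 0" by auto
  ultimately have dQ: "degree Q = e" using Gd by (simp add: degree_mult_eq)
  have lQ: "lead_coeff Q = 1"
    using c1 coeff_mult_degree_bound[of Q e "G ^ d" "d * e"] dQ Gd by simp
  have "deg_lt (Q - G) e"
    unfolding deg_lt_iff_coeff
  proof (intro allI impI)
    fix i assume "e \<le> i"
    then show "coeff (Q - G) i = 0" using dQ lQ G coeff_eq_0[of Q i] coeff_eq_0[of G i]
      by (cases "i = e") auto
  qed
  then show "lead_coeff (F div G ^ d) = 1" "degree (F div G ^ d) = e" "deg_lt (F div G ^ d - G) e"
    using dQ lQ by (auto simp: Q_def)
qed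

text \<open>The iteration divides only by monic polynomials and by \<open>d + 1\<close>, so it never
  leaves \<open>C\<close>. With uniqueness, an approximate root found over a larger ring then has
  its coefficients in \<open>C\<close>.\<close>

lemma approximate_root_exists_in:
  fixes F :: "'a::field_char_0 poly"
  assumes C: "subring_set C" and inv: "1 / of_nat (Suc d) \<in> C"
    and F: "F \<in> polys_in C" "lead_coeff F = 1" "degree F = Suc d * e" and e: "e > 0"
  shows "\<exists>P\<in>polys_in C. lead_coeff P = 1 \<and> degree P = e \<and> deg_lt (F - P ^ Suc d) (d * e)"
proof -
  interpret C: subring_set C by fact
  interpret P: subring_set "polys_in C" by (rule C.subring_polys_in)
  define I where "I = (\<lambda>G. G \<in> polys_in C \<and> lead_coeff G = 1 \<and> degree G = e)"
  have "\<exists>P. I P \<and> deg_lt (F - P ^ Suc d) (d * e)"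
  proof (rule approximate_root_induct[OF F(2,3) e])
    show "I (monom 1 e)" by (auto simp: I_def degree_monom_eq)
    fix G assume G: "I G"
    then show "lead_coeff G = 1 \<and> degree G = e" by (auto simp: I_def)
    have "F div G ^ d \<in> polys_in C"
      using G degree_monic_power[of G d] F(1) by (intro monic_div_mod_in[OF C]) (auto simp: I_def)
    moreover have "deg_lt (F div G ^ d - G) e" using F G e by (intro degree_div_monic_power) (auto simp: I_def)
    then have "deg_lt (smult (1 / of_nat (Suc d)) (F div G ^ d - G)) e" by (rule deg_lt_smult)
    ultimately show "I (G + smult (1 / of_nat (Suc d)) (F div G ^ d - G))"
      using monic_add_deg_lt[of G e "smult (1 / of_nat (Suc d)) (F div G ^ d - G)"] G inv
      unfolding I_def by (metis C.smult_in P.add_in P.diff_in)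
  qed
  then show ?thesis by (auto simp: I_def)
qed

unbundle Formal_Power_Series.fps_syntax
unbundle Formal_Laurent_Series.fps_syntax

section \<open>Laurent series\<close>

text \<open>Unlike \<open>c \<le> fls_subdegree x\<close>, which depends on the convention \<open>fls_subdegree 0 = 0\<close>, the
  following holds for \<open>x = 0\<close> and every \<open>c\<close>.\<close>

definition ord_ge :: "int \<Rightarrow> 'a::zero fls \<Rightarrow> bool" where
  "ord_ge c x \<longleftrightarrow> (\<forall>j<c. x $$ j = 0)"

lemma ord_ge_0 [simp]: "ord_ge c 0"
  by (simp add: ord_ge_def)

lemma ord_ge_mono: "ord_ge c x \<Longrightarrow> d \<le> c \<Longrightarrow> ord_ge d x"
  by (auto simp: ord_ge_def)

lemma ord_ge_iff_subdegree: "x \<noteq> 0 \<Longrightarrow> ord_ge c x \<longleftrightarrow> c \<le> fls_subdegree x"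
  unfolding ord_ge_def by (meson fls_eq0_below_subdegree fls_subdegree_geI order_less_le_trans)

lemma ord_ge_subdegree [simp]: "ord_ge (fls_subdegree x) x"
  by (simp add: ord_ge_def)

lemma ord_ge_add: "ord_ge c x \<Longrightarrow> ord_ge c y \<Longrightarrow> ord_ge c (x + y)"
  for x :: "'a::monoid_add fls"
  by (simp add: ord_ge_def)

lemma ord_ge_diff: "ord_ge c x \<Longrightarrow> ord_ge c y \<Longrightarrow> ord_ge c (x - y)"
  for x :: "'a::group_add fls"
  by (simp add: ord_ge_def)

lemma ord_ge_sum: "(\<And>i. i \<in> I \<Longrightarrow> ord_ge c (f i)) \<Longrightarrow> ord_ge c (sum f I)"
  for f :: "'b \<Rightarrow> 'a::comm_monoid_add fls"
  by (induction I rule: infinite_finite_induct) (auto intro: ord_ge_add)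

lemma subdegree_eqI_ord_ge: "ord_ge c x \<Longrightarrow> x $$ c \<noteq> 0 \<Longrightarrow> fls_subdegree x = c"
  by (auto simp: ord_ge_def intro: fls_subdegree_eqI)

text \<open>The summation window comes from lower bounds of the orders, not from the orders
  themselves, so leading coefficients of products can be computed even when they may vanish.\<close>

lemma fls_times_nth_ord_ge:
  fixes x y :: "'a::comm_ring_1 fls"
  assumes x: "ord_ge c x" and y: "ord_ge d y"
  shows "(x * y) $$ n = (\<Sum>i=c..n-d. x $$ i * y $$ (n - i))"
proof (cases "x = 0 \<or> y = 0")
  case False
  then have le: "c \<le> fls_subdegree x" "d \<le> fls_subdegree y"
    using x y by (simp_all add: ord_ge_iff_subdegree)
  show ?thesis
    unfolding fls_times_nth(2)
  proof (rule sum.mono_neutral_left)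
    show "\<forall>i\<in>{c..n - d} - {fls_subdegree x..n - fls_subdegree y}. x $$ i * y $$ (n - i) = 0"
    proof
      fix i assume "i \<in> {c..n - d} - {fls_subdegree x..n - fls_subdegree y}"
      then have "i < fls_subdegree x \<or> n - i < fls_subdegree y" by auto
      then show "x $$ i * y $$ (n - i) = 0" by auto
    qed
  qed (use le in auto)
qed auto

lemma lead_mult:
  fixes x y :: "'a::comm_ring_1 fls"
  assumes "ord_ge c x" "ord_ge d y"
  shows "(x * y) $$ (c + d) = x $$ c * y $$ d"
  using fls_times_nth_ord_ge[OF assms, of "c + d"] by simp

lemma ord_ge_mult:
  fixes x y :: "'a::comm_ring_1 fls"
  assumes "ord_ge c x" "ord_ge d y"
  shows "ord_ge (c + d) (x * y)"
  unfolding ord_ge_def using fls_times_nth_ord_ge[OF assms] by auto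

lemma ord_ge_one: "ord_ge 0 (1 :: 'a::comm_ring_1 fls)"
  by (simp add: ord_ge_def)

lemma ord_ge_prod:
  fixes x :: "'b \<Rightarrow> 'a::comm_ring_1 fls"
  assumes "\<And>i. i \<in> I \<Longrightarrow> ord_ge (c i) (x i)"
  shows "ord_ge (sum c I) (prod x I)"
  using assms by (induction I rule: infinite_finite_induct) (auto intro: ord_ge_mult ord_ge_one)

lemma lead_prod:
  fixes x :: "'b \<Rightarrow> 'a::comm_ring_1 fls"
  assumes "\<And>i. i \<in> I \<Longrightarrow> ord_ge (c i) (x i)"
  shows "prod x I $$ sum c I = (\<Prod>i\<in>I. x i $$ c i)"
  using assms
  by (induction I rule: infinite_finite_induct) (auto simp: lead_mult ord_ge_prod)

definition fls_map :: "('a::zero \<Rightarrow> 'b::zero) \<Rightarrow> 'a fls \<Rightarrow> 'b fls" where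
  "fls_map h x = Abs_fls (\<lambda>j. h (x $$ j))"

lemma fls_map_nth: "h 0 = 0 \<Longrightarrow> fls_map h x $$ j = h (x $$ j)"
  unfolding fls_map_def
  by (subst nth_Abs_fls_lower_bound[of "fls_subdegree x"]) auto

lemma ord_ge_fls_map: "h 0 = 0 \<Longrightarrow> ord_ge c x \<Longrightarrow> ord_ge c (fls_map h x)"
  by (auto simp: ord_ge_def fls_map_nth)

lemma ring_map_fls_map:
  assumes "ring_map h"
  shows "ring_map (fls_map h)"
proof -
  interpret ring_map h by fact
  show ?thesis
  proof
    fix x y :: "'a fls"
    let ?c = "fls_subdegree x" and ?d = "fls_subdegree y"
    show "fls_map h (x * y) = fls_map h x * fls_map h y"
      by (rule fls_eqI)
        (simp add: fls_map_nth fls_times_nth_ord_ge[of ?c _ ?d] ord_ge_fls_map map_sum)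
  qed (auto intro!: fls_eqI simp: fls_map_nth)
qed

lemma ring_map_fls_const: "ring_map (fls_const :: 'a::comm_ring_1 \<Rightarrow> 'a fls)"
  by unfold_locales (auto simp: fls_plus_const fls_const_mult_const)

section \<open>Evaluation of polynomials at Laurent series\<close>

abbreviation lift_poly :: "'a::comm_ring_1 poly \<Rightarrow> 'a fls poly" where
  "lift_poly \<equiv> map_poly fls_const"

abbreviation eval_fls :: "'a::comm_ring_1 poly \<Rightarrow> 'a fls \<Rightarrow> 'a fls" where
  "eval_fls q x \<equiv> poly (lift_poly q) x"

lemma degree_lift_poly [simp]: "degree (lift_poly q) = degree q"
  by (rule degree_map_poly) simp

text \<open>As \<theta> has a simple pole, \<open>\<theta> ^ k\<close> has order exactly
  \<open>- k\<close>, and the top term of \<open>q\<close> dominates. This translates degrees in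
  \<open>t\<close> into orders in \<tau>.\<close>

lemma subdegree_eval_fls:
  fixes \<theta> :: "'a::field fls"
  assumes "fls_subdegree \<theta> = -1" and "q \<noteq> 0"
  shows "ord_ge (- int (degree q)) (eval_fls q \<theta>)"
    and "eval_fls q \<theta> $$ (- int (degree q)) \<noteq> 0"
proof -
  have pw: "ord_ge (- int k) (\<theta> ^ k)" "(\<theta> ^ k) $$ (- int k) = (\<theta> $$ -1) ^ k" for k
  proof -
    have *: "ord_ge (sum (\<lambda>_. -1) {..<k}) (\<Prod>i<k. \<theta>)"
      "(\<Prod>i<k. \<theta>) $$ (sum (\<lambda>_. -1) {..<k}) = (\<Prod>i<k. \<theta> $$ -1)"
      using ord_ge_subdegree[of \<theta>] assms by (intro ord_ge_prod lead_prod; simp)+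
    show "ord_ge (- int k) (\<theta> ^ k)" "(\<theta> ^ k) $$ (- int k) = (\<theta> $$ -1) ^ k" using * by simp_all
  qed
  have \<theta>0: "\<theta> $$ -1 \<noteq> 0"
    using assms(1) by (metis fls_zero_subdegree nth_fls_subdegree_nonzero zero_neq_neg_one)
  let ?n = "degree q"
  have eq: "eval_fls q \<theta> = (\<Sum>k\<le>?n. fls_const (coeff q k) * \<theta> ^ k)"
    by (simp add: poly_altdef coeff_map_poly)
  have tm: "ord_ge (- int k) (fls_const (coeff q k) * \<theta> ^ k)" for k
    using ord_ge_mult[of 0 "fls_const (coeff q k)" "- int k" "\<theta> ^ k"] pw by (auto simp: ord_ge_def)
  show "ord_ge (- int ?n) (eval_fls q \<theta>)"
    unfolding eq by (intro ord_ge_sum ord_ge_mono[OF tm]) auto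
  have "eval_fls q \<theta> $$ (- int ?n) = (\<Sum>k\<le>?n. (fls_const (coeff q k) * \<theta> ^ k) $$ (- int ?n))"
    unfolding eq by (induction rule: infinite_finite_induct) auto
  also have "\<dots> = (\<Sum>k\<in>{?n}. (fls_const (coeff q k) * \<theta> ^ k) $$ (- int ?n))"
    using tm by (intro sum.mono_neutral_right) (auto simp: ord_ge_def)
  also have "\<dots> = lead_coeff q * (\<theta> $$ -1) ^ ?n"
    using lead_mult[of 0 "fls_const (coeff q ?n)" "- int ?n" "\<theta> ^ ?n"] pw by (simp add: ord_ge_def)
  finally show "eval_fls q \<theta> $$ (- int ?n) \<noteq> 0" using \<theta>0 assms(2) by simp
qed

lemma fls_subdegree_eval_fls:
  fixes \<theta> :: "'a::field fls"
  assumes "fls_subdegree \<theta> = -1" and "q \<noteq> 0"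
  shows "fls_subdegree (eval_fls q \<theta>) = - int (degree q)"
  using subdegree_eval_fls[OF assms] by (rule subdegree_eqI_ord_ge)

text \<open>For nonzero \<open>w\<close> this is the automorphism
  \<open>\<tau> \<mapsto> w \<tau>\<close> of \<open>k((\<tau>))\<close>. For \<open>k\<close>
  algebraically closed of characteristic 0, those with \<open>w ^ n = 1\<close> form the Galois
  group over \<open>k((\<tau> ^ n))\<close>.\<close>

definition twist :: "'a::field \<Rightarrow> 'a fls \<Rightarrow> 'a fls" where
  "twist w x = fls_compose_fps x (fps_const w * fps_X)"

context
  fixes w :: "'a::field"
  assumes w: "w \<noteq> 0"
begin

lemma twist_nth: "twist w x $$ j = x $$ j * w powi j"
  using w by (simp add: twist_def fls_nth_fls_compose_fps_linear)

lemma ring_map_twist: "ring_map (twist w)"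
proof -
  have *: "fps_const w * fps_X \<noteq> 0" "(fps_const w * fps_X) $ 0 = 0"
    using w by (auto simp: fps_eq_iff)
  show ?thesis
    by unfold_locales
      (use * in \<open>simp_all add: twist_def fls_compose_fps_add fls_compose_fps_mult\<close>)
qed

lemma ord_ge_twist: "ord_ge c (twist w x) \<longleftrightarrow> ord_ge c x"
  using w by (auto simp: ord_ge_def twist_nth)

lemma twist_0 [simp]: "twist w 0 = 0"
  by (simp add: twist_def)

lemma subdegree_twist [simp]: "fls_subdegree (twist w x) = fls_subdegree x"
proof (cases "x = 0")
  case False
  then show ?thesis using w by (intro fls_subdegree_eqI) (auto simp: twist_nth)
qed (simp add: twist_def)

lemma twist_const [simp]: "twist w (fls_const c) = fls_const c"
  by (rule fls_eqI) (auto simp: twist_nth)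

lemma twist_X_intpow: "w powi n = 1 \<Longrightarrow> twist w (fls_X_intpow n) = fls_X_intpow n"
  by (rule fls_eqI) (auto simp: twist_nth)

lemma twist_eval_fls: "twist w (eval_fls q x) = eval_fls q (twist w x)"
proof -
  interpret T: ring_map "twist w" by (rule ring_map_twist)
  interpret K: ring_map fls_const by (rule ring_map_fls_const)
  have "map_poly (twist w) (lift_poly q) = lift_poly q"
    by (rule poly_eqI) (simp add: coeff_map_poly)
  then show ?thesis using T.poly_map_poly[of "lift_poly q" x] by simp
qed

end

lemma twist_twist: "v \<noteq> 0 \<Longrightarrow> w \<noteq> 0 \<Longrightarrow> twist v (twist w x) = twist (v * w) x" for v :: "'a::field"
  by (rule fls_eqI) (simp add: twist_nth power_int_mult_distrib)

lemma twist_1 [simp]: "twist 1 x = x"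
  by (rule fls_eqI) (simp add: twist_nth)

lemma eval_fls_fps_to_fls:
  fixes s :: "'a::field fps"
  assumes "s $ 0 = 0"
  shows "poly (map_poly fls_const q) (fps_to_fls s) = fps_to_fls (fps_of_poly q oo s)"
proof (induction q)
  case (pCons a q)
  interpret K: ring_map fls_const by (rule ring_map_fls_const)
  show ?case using pCons assms
    by (simp add: fps_of_poly_pCons fps_compose_add_distrib fps_compose_mult_distrib
      fls_times_fps_to_fls algebra_simps)
qed auto

text \<open>Near infinity \<open>f\<close> is the power with exponent \<open>- n\<close> of a local
  parameter, obtained by extracting an \<open>n\<close>-th root of the reversed polynomial, whose
  constant term is nonzero. Inverting that parameter as a power series gives \<theta>.\<close>

lemma inverse_parametrization:
  fixes f :: "'a::{alg_closed_field, field_char_0} poly"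
  assumes n: "degree f = n" "n > 0"
  shows "\<exists>\<theta>. fls_subdegree \<theta> = -1 \<and> eval_fls f \<theta> = fls_X_intpow (- int n)"
proof -
  define v where "v = fps_of_poly (reflect_poly f)"
  have v0: "v $ 0 \<noteq> 0" using n by (auto simp: v_def)
  define r where "r = (\<lambda>k c. SOME y::'a. y ^ k = c)"
  have r: "r n c ^ n = c" for c
    unfolding r_def using nth_root_exists[OF n(2)] by (rule someI_ex)
  define u where "u = fps_radical r n v"
  have un: "u ^ n = v"
    using power_radical[OF v0, of r "n - 1"] r n(2) by (simp add: u_def)
  then have u0: "u $ 0 \<noteq> 0" using v0 n(2)
    by (metis fps_power_zeroth power_0_left less_numeral_extra(3))
  \<comment> \<open>With \<open>s = 1 / \<theta>\<close> one has
    \<open>f(\<theta>) = v(s) / s ^ n = (u(s) / s) ^ n\<close>, so it suffices that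
    \<open>s / u(s)\<close> is the variable.\<close>
  define s where "s = fps_inv (fps_X * inverse u)"
  have s0: "s $ 0 = 0" by (simp add: s_def fps_inv_def)
  have "(fps_X * inverse u) oo s = fps_X"
    unfolding s_def using u0 by (intro fps_inv_right) auto
  then have "s * inverse (u oo s) = fps_X"
    using s0 u0 by (simp add: fps_compose_mult_distrib fps_inverse_compose)
  moreover have us: "(u oo s) $ 0 \<noteq> 0" using u0 by simp
  ultimately have s: "s = fps_X * (u oo s)"
    by (metis inverse_mult_eq_1 mult.assoc mult.right_neutral)
  then have sn: "s ^ n = fps_X ^ n * (v oo s)"
    by (metis fps_compose_power power_mult_distrib s0 un)
  have s1: "subdegree s = 1"
    using s us by (metis add.right_neutral fps_X_neq_zero fps_nonzero_nth nth_subdegree_nonzero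
        subdegree_eq_0 subdegree_fps_X subdegree_mult)
  define S where "S = fps_to_fls s"
  have S: "fls_subdegree S = 1" using s1 by (simp add: S_def fls_subdegree_fls_to_fps)
  then have S0: "S \<noteq> 0" by auto
  have "eval_fls (reflect_poly f) S = S ^ n * eval_fls f (inverse S)"
  proof -
    have "lift_poly (reflect_poly f) = reflect_poly (lift_poly f)"
      by (rule poly_eqI) (simp add: coeff_map_poly coeff_reflect_poly)
    then show ?thesis using S0 n by (simp add: poly_reflect_poly_nz)
  qed
  moreover have "eval_fls (reflect_poly f) S = fps_to_fls (v oo s)"
    unfolding S_def v_def using s0 by (rule eval_fls_fps_to_fls)
  moreover have "S ^ n = fls_X ^ n * fps_to_fls (v oo s)"
    unfolding S_def by (metis sn fps_to_fls_power fls_times_fps_to_fls fps_X_to_fls)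
  moreover have "fps_to_fls (v oo s) \<noteq> 0"
    using v0 by (metis fps_compose_nth_0 fps_to_fls_eq_0_iff fps_zero_nth)
  ultimately have "fls_X ^ n * eval_fls f (inverse S) = 1" by simp
  then have "eval_fls f (inverse S) = inverse (fls_X ^ n)" by (metis inverse_unique)
  also have "\<dots> = fls_X_intpow (- int n)"
    using fls_inverse_X_intpow[of "int n", where 'a='a] by (simp add: fls_X_power_conv_shift_1)
  finally show ?thesis using S S0 by (intro exI[of _ "inverse S"]) simp
qed

section \<open>Approximate roots and conjugate truncations\<close>

abbreviation cst :: "'a::comm_ring_1 fls \<Rightarrow> 'a poly fls" where
  "cst \<equiv> fls_map (\<lambda>c. [:c:])"

lemma ring_map_const_poly: "ring_map (\<lambda>c::'a::comm_ring_1. [:c:])"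
  by unfold_locales (auto simp: one_pCons)

lemma ring_map_cst: "ring_map (cst :: 'a::comm_ring_1 fls \<Rightarrow> _)"
  by (intro ring_map_fls_map ring_map_const_poly)

lemma cst_nth: "cst x $$ j = [:x $$ j:]"
  by (simp add: fls_map_nth)

lemma prod_const_poly: "(\<Prod>i\<in>I. [:c i:]) = [:\<Prod>i\<in>I. c i:]" for c :: "'b \<Rightarrow> 'a::comm_ring_1"
  by (induction I rule: infinite_finite_induct) (auto simp: one_pCons)

lemma monic_linear_prod:
  fixes A :: "'a::idom set"
  assumes "finite A"
  shows "degree (\<Prod>v\<in>A. [:- v, 1:]) = card A" "lead_coeff (\<Prod>v\<in>A. [:- v, 1:]) = 1"
proof -
  show *: "degree (\<Prod>v\<in>A. [:- v, 1:]) = card A" using assms by (simp add: degree_prod_sum_eq)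
  show "lead_coeff (\<Prod>v\<in>A. [:- v, 1:]) = 1" by (simp add: lead_coeff_prod)
qed

text \<open>Used with \<open>L0\<close> the series fixed by all twists, \<open>u\<close> the part of
  \<gamma> with exponents divisible by \<open>d\<close>, \<open>r\<close> the rest of \<gamma> and
  \<open>U\<close> the conjugates of \<open>u\<close>. By \<open>sep\<close> the disc of the points
  \<open>x\<close> for which \<open>x - u\<close> has order at least \<rho> contains no conjugate
  other than \<open>u\<close>.\<close>

locale conjugate_level =
  fixes L0 :: "'a::field_char_0 fls set" and u r :: "'a fls" and U :: "'a fls set" and \<rho> :: int
  assumes subring_L0: "subring_set L0"
    and fin: "finite U" and u_in: "u \<in> U"
    and conj: "\<And>v. v \<in> U \<Longrightarrow> \<exists>s. ring_map s \<and> s u = v \<and> bij_betw s U U \<and> (\<forall>x\<in>L0. s x = x)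
      \<and> (\<forall>x. fls_subdegree (s x) = fls_subdegree x)"
    and sep: "\<And>v. v \<in> U \<Longrightarrow> v \<noteq> u \<Longrightarrow> fls_subdegree (u - v) < \<rho>"
    and r: "r \<noteq> 0" "fls_subdegree r = \<rho>"
    and G_in: "(\<Prod>v\<in>U. [:- v, 1:]) \<in> polys_in L0"
begin

text \<open>The order of a polynomial at \<open>u + Z r\<close>, with an indeterminate \<open>Z\<close>, is its Gauss valuation on the
  disc around \<open>u\<close> that contains \<open>u + r\<close>; it is multiplicative because \<open>k[Z]((\<tau>))\<close> is a domain.\<close>

definition "generic = cst u + fls_const [:0, 1:] * cst r"
definition "ev Q = poly (map_poly cst Q) generic"
definition "G = (\<Prod>v\<in>U. [:- v, 1:])"
text \<open>\<open>\<kappa>\<close> is the order of the derivative of \<open>G\<close> at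
  \<open>u\<close>, and \<open>D\<close> will be the Gauss valuation of \<open>G\<close> on the
  disc.\<close>

definition "\<kappa> = (\<Sum>v\<in>U-{u}. fls_subdegree (u - v))"
definition "D = \<rho> + \<kappa>"

sublocale L0: subring_set L0 by (rule subring_L0)
sublocale PL0: subring_set "polys_in L0" by (rule L0.subring_polys_in)
sublocale cst: ring_map cst by (rule ring_map_cst)
sublocale ev: ring_map ev
  unfolding ev_def[abs_def] by (rule cst.ring_map_poly_map_poly)

lemma ev_const: "ev [:c:] = cst c"
  by (simp add: ev_def)

lemma ev_linear: "ev [:- v, 1:] = cst (u - v) + fls_const [:0, 1:] * cst r"
  by (simp add: ev_def generic_def)

lemma ord_ge_cst: "ord_ge c x \<Longrightarrow> ord_ge c (cst x)"
  by (simp add: ord_ge_fls_map)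

lemma ord_Z: "ord_ge \<rho> (fls_const [:0, 1:] * cst r)" "(fls_const [:0, 1:] * cst r) $$ j = [:0, r $$ j:]"
proof -
  show "ord_ge \<rho> (fls_const [:0, 1:] * cst r)"
    using ord_ge_mult[of 0 "fls_const [:0, 1:]" \<rho> "cst r"] ord_ge_cst[OF ord_ge_subdegree, of r] r
    by (auto simp: ord_ge_def)
  show "(fls_const [:0, 1:] * cst r) $$ j = [:0, r $$ j:]"
    by (simp add: cst_nth)
qed

text \<open>The Gauss valuation of the linear factor at \<open>v\<close>: the distance to
  \<open>v\<close> is the same from all points of the disc unless \<open>v = u\<close>.\<close>

definition "w v = (if v = u then \<rho> else fls_subdegree (u - v))"

lemma ord_ge_linear: "v \<in> U \<Longrightarrow> ord_ge (w v) (ev [:- v, 1:])"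
  unfolding ev_linear w_def using ord_Z(1) sep[of v]
  by (auto intro!: ord_ge_add ord_ge_cst intro: ord_ge_mono simp del: cst.map_diff)

lemma lead_linear:
  "v \<in> U \<Longrightarrow> v \<noteq> u \<Longrightarrow> ev [:- v, 1:] $$ w v = [:(u - v) $$ fls_subdegree (u - v):]"
  "ev [:- u, 1:] $$ w u = [:0, r $$ \<rho>:]"
proof -
  show "ev [:- u, 1:] $$ w u = [:0, r $$ \<rho>:]"
    by (simp add: ev_linear w_def cst_nth ord_Z(2) del: fls_minus_nth cst.map_diff)
  assume v: "v \<in> U" "v \<noteq> u"
  then have "r $$ fls_subdegree (u - v) = 0" using sep[OF v] r by auto
  with v show "ev [:- v, 1:] $$ w v = [:(u - v) $$ fls_subdegree (u - v):]"
    by (simp add: ev_linear w_def cst_nth ord_Z(2) del: fls_minus_nth cst.map_diff)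
qed

lemma sum_w: "sum w U = D"
proof -
  have "sum w U = w u + sum w (U - {u})" using fin u_in by (rule sum.remove)
  also have "sum w (U - {u}) = \<kappa>" unfolding \<kappa>_def by (rule sum.cong) (auto simp: w_def)
  finally show ?thesis by (simp add: w_def D_def)
qed

lemma sum_conj:
  assumes "v \<in> U"
  shows "(\<Sum>v'\<in>U-{v}. fls_subdegree (v - v')) = \<kappa>"
proof -
  obtain s where s: "ring_map s" "s u = v" "bij_betw s U U" "\<forall>x. fls_subdegree (s x) = fls_subdegree x"
    using conj[OF assms] by (elim exE conjE)
  interpret s: ring_map s by fact
  have "bij_betw s (U - {u}) (U - {v})"
    using bij_betw_DiffI[OF s(3), of "{u}" "{v}"] s(2) u_in assms by simp
  then have "(\<Sum>v'\<in>U-{v}. fls_subdegree (v - v')) = (\<Sum>v'\<in>U-{u}. fls_subdegree (v - s v'))"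
    by (rule sum.reindex_bij_betw[symmetric])
  also have "\<dots> = \<kappa>"
  proof -
    have "fls_subdegree (v - s v') = fls_subdegree (u - v')" for v'
      using s(4)[rule_format, of "u - v'"] s(2) by simp
    then show ?thesis by (simp add: \<kappa>_def)
  qed
  finally show ?thesis .
qed

text \<open>The automorphism that takes \<open>u\<close> to \<open>v\<close> fixes the coefficients
  of \<open>A\<close>, hence takes \<open>poly A u\<close> to \<open>poly A v\<close>.\<close>

lemma poly_conj:
  assumes "v \<in> U" "A \<in> polys_in L0"
  shows "fls_subdegree (poly A v) = fls_subdegree (poly A u)" "poly A v = 0 \<longleftrightarrow> poly A u = 0"
proof -
  obtain s where s: "ring_map s" "s u = v" "\<forall>x\<in>L0. s x = x" "\<forall>x. fls_subdegree (s x) = fls_subdegree x"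
    using conj[OF assms(1)] by (elim exE conjE)
  interpret s: ring_map s by fact
  have "map_poly s A = A"
  proof (rule poly_eqI)
    fix n
    have "coeff A n \<in> L0" using assms(2) by (simp add: polys_in_def)
    with s(3) show "coeff (map_poly s A) n = coeff A n" unfolding s.coeff_map_poly' by (rule bspec)
  qed
  then have eq: "poly A v = s (poly A u)" using s.poly_map_poly[of A u] unfolding s(2) by (simp only:)
  show "fls_subdegree (poly A v) = fls_subdegree (poly A u)" unfolding eq using s(4) ..
  have "s x \<noteq> 0" if "x \<noteq> 0" for x
  proof
    assume "s x = 0"
    then have "s (x * inverse x) = 0" by (simp only: s.map_mult mult_zero_left)
    then show False using that by (simp del: s.map_mult)
  qed
  then show "poly A v = 0 \<longleftrightarrow> poly A u = 0" unfolding eq using s.map_0 by metis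
qed

text \<open>By Lagrange interpolation at the conjugates of \<open>u\<close>, the term at \<open>u\<close> itself dominates near \<open>u\<close>.\<close>

lemma constant_lead:
  assumes A: "A \<in> polys_in L0" "A \<noteq> 0" "degree A < card U"
  shows "\<exists>\<alpha> c. c \<noteq> 0 \<and> ord_ge \<alpha> (ev A) \<and> ev A $$ \<alpha> = [:c:]"
proof -
  have Au: "poly A u \<noteq> 0"
  proof
    assume "poly A u = 0"
    then have "A = 0"
      using poly_conj(2)[OF _ A(1)] A(3) by (intro poly_eqI_degree[of U]) auto
    with A show False by simp
  qed
  define \<alpha> where "\<alpha> = fls_subdegree (poly A u)"
  define W where "W = (\<lambda>v. \<Prod>v'\<in>U-{v}. v - v')"
  define c where "c = (\<lambda>v. poly A v / W v)"
  define M where "M = (\<lambda>v. \<Prod>v'\<in>U-{v}. [:- v', 1:])"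
  have W0: "W v \<noteq> 0" for v using fin by (auto simp: W_def)
  have subW: "fls_subdegree (W v) = \<kappa>" if "v \<in> U" for v
    using fin sum_conj[OF that] unfolding W_def by (subst fls_subdegree_prod) auto
  have subc: "fls_subdegree (c v) = \<alpha> - \<kappa>" if "v \<in> U" for v
    using that W0 poly_conj[OF that A(1)] Au subW[OF that]
    by (simp add: c_def \<alpha>_def fls_divide_subdegree)
  have lagrange: "A = (\<Sum>v\<in>U. smult (c v) (M v))"
  proof (rule poly_eqI_degree[of U])
    fix x assume x: "x \<in> U"
    have "poly (M v) x = (if v = x then W x else 0)" if "v \<in> U" for v
      using that x fin by (auto simp: M_def W_def poly_prod)
    then have "poly (\<Sum>v\<in>U. smult (c v) (M v)) x = (\<Sum>v\<in>U. if v = x then c v * W x else 0)"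
      unfolding poly_sum by (intro sum.cong) auto
    also have "\<dots> = poly A x" using x fin W0 by (simp add: c_def)
    finally show "poly A x = poly (\<Sum>v\<in>U. smult (c v) (M v)) x" ..
  next
    have "degree (smult (c v) (M v)) \<le> card U - 1" if "v \<in> U" for v
    proof -
      have "degree (M v) = card U - 1"
        unfolding M_def using that fin by (subst monic_linear_prod) auto
      then show ?thesis by (metis degree_smult_le)
    qed
    then have "degree (\<Sum>v\<in>U. smult (c v) (M v)) \<le> card U - 1" using fin by (intro degree_sum_le)
    then show "degree (\<Sum>v\<in>U. smult (c v) (M v)) < card U"
      using fin u_in by (metis card_gt_0_iff diff_less empty_iff le_less_trans less_one)
  qed (use A in auto)
  define t where "t = (\<lambda>v. cst (c v) * (\<Prod>v'\<in>U-{v}. ev [:- v', 1:]))"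
  have evA: "ev A = (\<Sum>v\<in>U. t v)"
  proof -
    have "smult (c v) (M v) = [:c v:] * M v" for v by simp
    then show ?thesis
      by (subst lagrange) (simp only: ev.map_sum ev.map_mult ev_const M_def ev.map_prod t_def)
  qed
  have ordc: "ord_ge (\<alpha> - \<kappa>) (cst (c v))" if "v \<in> U" for v
    using ord_ge_subdegree[of "c v"] subc[OF that] by (intro ord_ge_cst) simp
  have tv: "ord_ge (\<alpha> - \<kappa> + sum w (U - {v})) (t v)" if "v \<in> U" for v
    unfolding t_def using ordc[OF that] ord_ge_linear by (intro ord_ge_mult ord_ge_prod) auto
  \<comment> \<open>The term at \<open>v\<close> omits the factor of order \<open>w v\<close>
    instead of the one of order \<rho>, so its order is \<alpha> + \<rho> - \<open>w v\<close>,
    which exceeds \<alpha>.\<close>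
  have big: "ord_ge (\<alpha> + 1) (t v)" if "v \<in> U - {u}" for v
  proof -
    have "sum w U = w v + sum w (U - {v})" using fin that by (intro sum.remove) auto
    moreover have "w v < \<rho>" using sep that by (auto simp: w_def)
    ultimately have "\<alpha> + 1 \<le> \<alpha> - \<kappa> + sum w (U - {v})" by (simp add: sum_w D_def)
    then show ?thesis using tv that by (metis DiffD1 ord_ge_mono)
  qed
  have wu0: "w u = \<rho>" by (simp add: w_def)
  have wu: "sum w (U - {u}) = \<kappa>"
    using sum.remove[OF fin u_in, of w] wu0 by (simp add: sum_w D_def)
  have tu: "ord_ge \<alpha> (t u)" using tv[OF u_in] wu by simp
  \<comment> \<open>The term at \<open>u\<close> omits the only factor with \<open>Z\<close> in its
    leading coefficient, so its own leading coefficient is a constant.\<close>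
  define b where "b = c u $$ (\<alpha> - \<kappa>) * (\<Prod>v\<in>U-{u}. (u - v) $$ fls_subdegree (u - v))"
  have "t u $$ (\<alpha> - \<kappa> + sum w (U - {u})) = cst (c u) $$ (\<alpha> - \<kappa>) * (\<Prod>v'\<in>U-{u}. ev [:- v', 1:]) $$ sum w (U - {u})"
    unfolding t_def using ordc[OF u_in] ord_ge_linear by (intro lead_mult ord_ge_prod) auto
  also have "(\<Prod>v'\<in>U-{u}. ev [:- v', 1:]) $$ sum w (U - {u}) = (\<Prod>v\<in>U-{u}. [:(u - v) $$ fls_subdegree (u - v):])"
    using ord_ge_linear lead_linear(1) by (subst lead_prod) (auto simp del: fls_minus_nth)
  finally have lead: "t u $$ \<alpha> = [:b:]"
    by (simp add: wu prod_const_poly cst_nth b_def del: fls_minus_nth)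
  have "c u \<noteq> 0" using Au W0 by (simp add: c_def)
  then have "b \<noteq> 0"
    using subc[OF u_in] fin nth_fls_subdegree_nonzero[of "c u"] nth_fls_subdegree_nonzero[of "u - _"]
    by (auto simp: b_def simp del: fls_minus_nth)
  have rest: "ord_ge (\<alpha> + 1) (sum t (U - {u}))" by (intro ord_ge_sum big)
  have split: "ev A = t u + sum t (U - {u})" unfolding evA using fin u_in by (rule sum.remove)
  have "ord_ge \<alpha> (ev A)" unfolding split using tu rest by (intro ord_ge_add) (auto elim: ord_ge_mono)
  moreover have "ev A $$ \<alpha> = [:b:]" using rest lead by (simp add: split ord_ge_def)
  ultimately show ?thesis using \<open>b \<noteq> 0\<close> by blast
qed

text \<open>At leading order only the factor at \<open>u\<close> involves \<open>Z\<close>; the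
  others contribute nonzero constants.\<close>

lemma ev_G: "ord_ge D (ev G)" "\<exists>a. a \<noteq> 0 \<and> ev G $$ D = [:0, a:]"
proof -
  have G: "ev G = (\<Prod>v\<in>U. ev [:- v, 1:])" by (simp only: G_def ev.map_prod)
  show "ord_ge D (ev G)" unfolding G sum_w[symmetric] by (intro ord_ge_prod ord_ge_linear)
  have "ev G $$ D = (\<Prod>v\<in>U. ev [:- v, 1:] $$ w v)"
    unfolding G sum_w[symmetric] by (intro lead_prod ord_ge_linear)
  also have "\<dots> = ev [:- u, 1:] $$ w u * (\<Prod>v\<in>U-{u}. ev [:- v, 1:] $$ w v)"
    using fin u_in by (rule prod.remove)
  also have "(\<Prod>v\<in>U-{u}. ev [:- v, 1:] $$ w v) = (\<Prod>v\<in>U-{u}. [:(u - v) $$ fls_subdegree (u - v):])"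
    using lead_linear(1) by (intro prod.cong) auto
  finally have "ev G $$ D = [:0, r $$ \<rho> * (\<Prod>v\<in>U-{u}. (u - v) $$ fls_subdegree (u - v)):]"
    by (simp add: prod_const_poly lead_linear(2) mult.commute del: fls_minus_nth)
  moreover have "r $$ \<rho> * (\<Prod>v\<in>U-{u}. (u - v) $$ fls_subdegree (u - v)) \<noteq> 0"
    using r fin nth_fls_subdegree_nonzero[of r] nth_fls_subdegree_nonzero[of "u - _"]
    by (auto simp del: fls_minus_nth)
  ultimately show "\<exists>a. a \<noteq> 0 \<and> ev G $$ D = [:0, a:]" by blast
qed

text \<open>The invariant of Tschirnhausen's iteration on the disc: it keeps the bound
  \<open>D\<close> on the order and the linearity in \<open>Z\<close> of the coefficient at
  \<open>D\<close>.\<close>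

definition "near_G G' \<longleftrightarrow> G' \<in> polys_in L0 \<and> lead_coeff G' = 1 \<and> degree G' = card U \<and> ord_ge D (ev (G' - G))"

lemma near_G_G: "near_G G"
  using G_in monic_linear_prod[OF fin] by (simp add: near_G_def G_def)

lemma card_U: "card U > 0"
  using fin u_in by (auto simp: card_gt_0_iff)

text \<open>The difference \<open>G' - G\<close> has degree below \<open>card U\<close>, so by
  \<open>constant_lead\<close> it alters the coefficient at \<open>D\<close> by a constant only, and
  the term in \<open>Z\<close> survives.\<close>

lemma near_G_lead:
  assumes "near_G G'"
  shows "ord_ge D (ev G')" "degree (ev G' $$ D) = 1"
proof -
  define E where "E = ev (G' - G)"
  have eq: "ev G' = ev G + E" by (simp add: E_def)
  show "ord_ge D (ev G')" unfolding eq E_def using ev_G assms by (intro ord_ge_add) (auto simp: near_G_def)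
  obtain a where a: "a \<noteq> 0" "ev G $$ D = [:0, a:]" using ev_G by blast
  have "deg_lt (G' - G) (card U)"
  proof -
    have "degree G = card U" "lead_coeff G = 1" using monic_linear_prod[OF fin] by (auto simp: G_def)
    moreover have "degree G' = card U" "lead_coeff G' = 1" using assms by (auto simp: near_G_def)
    ultimately have "coeff (G' - G) i = 0" if "i \<ge> card U" for i
      using that coeff_eq_0[of G i] coeff_eq_0[of G' i] by (cases "i = card U") auto
    then show ?thesis by (simp add: deg_lt_iff_coeff)
  qed
  have "\<exists>c. ev (G' - G) $$ D = [:c:]"
  proof (cases "G' - G = 0")
    case False
    have "G' - G \<in> polys_in L0" using assms near_G_G by (auto simp: near_G_def)
    then obtain \<alpha> c where c: "c \<noteq> 0" "ord_ge \<alpha> (ev (G' - G))" "ev (G' - G) $$ \<alpha> = [:c:]"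
      using constant_lead[of "G' - G"] False \<open>deg_lt (G' - G) (card U)\<close> by (auto simp: deg_lt_def)
    have "\<not> \<alpha> < D" using c assms by (auto simp: near_G_def ord_ge_def)
    then show ?thesis using c by (cases "\<alpha> = D") (auto simp: ord_ge_def intro!: exI[of _ 0])
  next
    case True
    then have "ev (G' - G) $$ D = [:0:]" by (simp only: ev.map_0) simp
    then show ?thesis by blast
  qed
  then obtain c where "E $$ D = [:c:]" unfolding E_def by blast
  then have "ev G' $$ D = [:c, a:]" using a eq by simp
  then show "degree (ev G' $$ D) = 1" using a by simp
qed

text \<open>If the quotient had too small an order \<open>q\<close>, the leading coefficient of
  quotient times \<open>G'\<close>, at \<open>q + D\<close>, would have to be cancelled by the
  remainder. But the former is non-constant in \<open>Z\<close>, while the remainder has a constant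
  leading coefficient by \<open>constant_lead\<close>.\<close>

lemma division_bound:
  assumes G': "near_G G'" and B: "B \<in> polys_in L0" "ord_ge c (ev B)"
  shows "ord_ge (c - D) (ev (B div G'))"
proof (rule ccontr)
  assume neg: "\<not> ord_ge (c - D) (ev (B div G'))"
  define Q R where "Q = B div G'" and "R = B mod G'"
  have QR: "B = Q * G' + R" unfolding Q_def R_def by simp
  have G'0: "G' \<noteq> 0" using G' by (auto simp: near_G_def)
  have R_in: "R \<in> polys_in L0"
    unfolding R_def using G' B by (intro monic_div_mod_in(2)[OF subring_L0]) (auto simp: near_G_def)
  have R_deg: "R = 0 \<or> degree R < card U"
    using degree_mod_less[OF G'0, of B] G' by (auto simp: R_def near_G_def)
  have Q0: "ev Q \<noteq> 0" using neg by (auto simp: Q_def)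
  define q where "q = fls_subdegree (ev Q)"
  have q: "q + D < c" using neg Q0 by (simp add: Q_def q_def ord_ge_iff_subdegree)
  have ord: "ord_ge (q + D) (ev Q * ev G')"
    unfolding q_def using near_G_lead[OF G'] by (intro ord_ge_mult) auto
  have lead: "(ev Q * ev G') $$ (q + D) = ev Q $$ q * ev G' $$ D"
    unfolding q_def using near_G_lead[OF G'] by (intro lead_mult) auto
  have "ev Q $$ q \<noteq> 0" using Q0 by (simp add: q_def)
  then have deg: "degree ((ev Q * ev G') $$ (q + D)) \<ge> 1"
    unfolding lead using near_G_lead(2)[OF G'] by (subst degree_mult_eq) auto
  have eq: "ev R = ev B - ev Q * ev G'" by (simp add: QR)
  have "ord_ge (q + D) (ev R)" unfolding eq using ord ord_ge_mono[OF B(2)] q by (intro ord_ge_diff) auto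
  have "ev R $$ (q + D) = - ((ev Q * ev G') $$ (q + D))"
    using B(2) q by (simp add: eq ord_ge_def)
  then have degR: "degree (ev R $$ (q + D)) \<ge> 1" using deg by simp
  then have "R \<noteq> 0" by auto
  with R_deg R_in constant_lead obtain \<alpha> c' where c': "c' \<noteq> 0" "ord_ge \<alpha> (ev R)" "ev R $$ \<alpha> = [:c':]"
    by blast
  have "\<alpha> = q + D"
  proof (rule antisym; rule ccontr)
    assume "\<not> \<alpha> \<le> q + D"
    then have "ev R $$ (q + D) = 0" using c' by (simp add: ord_ge_def)
    then show False using degR by simp
  next
    assume "\<not> q + D \<le> \<alpha>"
    then show False using c' \<open>ord_ge (q + D) (ev R)\<close> by (simp add: ord_ge_def)
  qed
  then show False using c' degR by simp
qed

lemma division_power_bound: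
  assumes G': "near_G G'" and B: "B \<in> polys_in L0" "ord_ge c (ev B)"
  shows "B div G' ^ k \<in> polys_in L0 \<and> ord_ge (c - int k * D) (ev (B div G' ^ k))"
proof (induction k)
  case (Suc k)
  have eq: "B div G' ^ Suc k = (B div G' ^ k) div G'"
    by (simp add: poly_div_mult_right mult.commute[of G'])
  have "c - int (Suc k) * D = c - int k * D - D" by (simp add: algebra_simps)
  moreover have "(B div G' ^ k) div G' \<in> polys_in L0"
    using Suc G' by (intro monic_div_mod_in(1)[OF subring_L0, of G']) (auto simp: near_G_def)
  moreover have "ord_ge (c - int k * D - D) (ev ((B div G' ^ k) div G'))"
    using Suc by (intro division_bound[OF G']) auto
  ultimately show ?case unfolding eq by (simp only:)
qed (use B in auto)

text \<open>Dividing \<open>F\<close> by the \<open>d\<close>-th power of the current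
  \<open>G'\<close> leaves order at least \<open>(d + 1) * D - d * D = D\<close>, so every
  correction preserves \<open>near_G\<close>.\<close>

lemma approximate_root_bound:
  assumes F: "F \<in> polys_in L0" "lead_coeff F = 1" "degree F = Suc d * card U"
    and F_bound: "ord_ge (int (Suc d) * D) (ev F)" and inv: "fls_const (1 / of_nat (Suc d)) \<in> L0"
  shows "\<exists>P\<in>polys_in L0. lead_coeff P = 1 \<and> degree P = card U \<and>
    deg_lt (F - P ^ Suc d) (d * card U) \<and> ord_ge D (poly P (u + r))"
proof -
  have inv': "1 / of_nat (Suc d) = fls_const (1 / of_nat (Suc d) :: 'a)"
    by (simp add: fls_of_nat divide_inverse fls_inverse_const del: of_nat_Suc)
  have "\<exists>P. near_G P \<and> deg_lt (F - P ^ Suc d) (d * card U)"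
  proof (rule approximate_root_induct[where I = near_G, OF F(2,3) card_U _ _ near_G_G])
    fix G' assume G': "near_G G'"
    then show G'': "lead_coeff G' = 1 \<and> degree G' = card U" by (auto simp: near_G_def)
    let ?Q = "F div G' ^ d" and ?i = "1 / of_nat (Suc d) :: 'a fls"
    have "?Q \<in> polys_in L0 \<and> ord_ge (int (Suc d) * D - int d * D) (ev ?Q)"
      using G' F(1) F_bound by (rule division_power_bound)
    then have Q: "?Q \<in> polys_in L0" "ord_ge D (ev ?Q)" by (auto simp: algebra_simps)
    have ordB: "ord_ge D (ev (?Q - G'))"
      using Q(2) near_G_lead(1)[OF G'] by (simp add: ord_ge_diff)
    have ord: "ord_ge D (ev (smult ?i (?Q - G')))"
    proof -
      have "smult ?i (?Q - G') = [:?i:] * (?Q - G')" by simp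
      then have "ev (smult ?i (?Q - G')) = cst ?i * ev (?Q - G')" by (simp only: ev.map_mult ev_const)
      moreover have "ord_ge 0 (cst ?i)" unfolding inv' by (intro ord_ge_cst) (simp add: ord_ge_def)
      ultimately show ?thesis using ord_ge_mult[of 0 "cst ?i" D] ordB by simp
    qed
    have "deg_lt (?Q - G') (card U)"
      using F(2,3) G'' card_U by (intro degree_div_monic_power) auto
    then have "deg_lt (smult ?i (?Q - G')) (card U)" by (rule deg_lt_smult)
    then have "lead_coeff (G' + smult ?i (?Q - G')) = 1" "degree (G' + smult ?i (?Q - G')) = card U"
      using monic_add_deg_lt G'' by blast+
    moreover have "G' + smult ?i (?Q - G') \<in> polys_in L0"
      using Q(1) G' inv inv' unfolding near_G_def by (metis L0.smult_in PL0.add_in PL0.diff_in)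
    moreover have "ord_ge D (ev (G' + smult ?i (?Q - G') - G))"
    proof -
      have "ev (G' + smult ?i (?Q - G') - G) = ev (G' - G) + ev (smult ?i (?Q - G'))"
        by (simp only: ev.map_add ev.map_diff) (simp add: algebra_simps)
      then show ?thesis using ord G' by (simp only: near_G_def ord_ge_add)
    qed
    ultimately show "near_G (G' + smult ?i (?Q - G'))" by (simp only: near_G_def)
  qed
  then obtain P where P: "near_G P" "deg_lt (F - P ^ Suc d) (d * card U)" by blast
  \<comment> \<open>Setting \<open>Z = 1\<close> takes the generic point to \<open>u + r\<close> and
    cannot lower the order.\<close>
  define sp where "sp = fls_map (\<lambda>q::'a poly. poly q 1)"
  interpret sp: ring_map sp unfolding sp_def by (intro ring_map_fls_map ring_map_poly)
  have sp_cst: "sp (cst x) = x" for x by (rule fls_eqI) (simp add: sp_def fls_map_nth)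
  have "sp (fls_const [:0, 1:]) = 1" by (rule fls_eqI) (simp add: sp_def fls_map_nth)
  then have sp_gen: "sp generic = u + r" by (simp add: generic_def sp_cst)
  have "map_poly sp (map_poly cst P) = P" by (rule poly_eqI) (simp add: sp_cst)
  then have "sp (ev P) = poly P (u + r)"
    unfolding ev_def using sp.poly_map_poly[of "map_poly cst P" generic] sp_gen by simp
  moreover have "ord_ge D (sp (ev P))"
    unfolding sp_def using near_G_lead(1)[OF P(1)] by (intro ord_ge_fls_map) auto
  ultimately show ?thesis using P by (auto simp: near_G_def)
qed

end

section \<open>Roots of unity\<close>

text \<open>The polynomial \<open>X ^ n - 1\<close> splits, and a double root would also be a root
  of its derivative, hence zero.\<close>

lemma card_roots_of_unity:
  fixes n :: nat
  assumes "n > 0"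
  shows "card {w :: 'a::{alg_closed_field, field_char_0}. w ^ n = 1} = n"
proof -
  define q where "q = monom 1 n - (1 :: 'a poly)"
  have cq: "coeff q n = 1" using assms by (simp add: q_def)
  have "degree q \<le> n" unfolding q_def by (intro degree_diff_le) (auto simp: degree_monom_le)
  moreover have "n \<le> degree q" using cq by (intro le_degree) simp
  ultimately have dq: "degree q = n" by simp
  have pq: "poly q w = w ^ n - 1" for w by (simp add: q_def poly_monom)
  have "q \<noteq> 0" using cq by auto
  then obtain A where A: "size A = n" "q = smult (lead_coeff q) (\<Prod>x\<in>#A. [:-x, 1:])"
    using alg_closed_imp_factorization dq by blast
  have Aq: "q = (\<Prod>x\<in>#A. [:-x, 1:])" using A(2) cq dq by simp
  have roots: "{w. w ^ n = 1} = set_mset A"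
  proof -
    have "w \<in># A \<longleftrightarrow> poly q w = 0" for w
      unfolding Aq poly_prod_mset by (auto simp: prod_mset_zero_iff)
    then show ?thesis by (auto simp: pq)
  qed
  have "count A x = 1" if "x \<in># A" for x
  proof (rule ccontr)
    assume "count A x \<noteq> 1"
    obtain B where B: "A = add_mset x B" using multi_member_split[OF \<open>x \<in># A\<close>] by blast
    with \<open>count A x \<noteq> 1\<close> have "x \<in># B" by (simp add: not_in_iff)
    then obtain B' where "B = add_mset x B'" using multi_member_split by metis
    then have "q = [:-x, 1:] * ([:-x, 1:] * (\<Prod>x\<in>#B'. [:-x, 1:]))" using Aq B by simp
    then have "poly (pderiv q) x = 0" by (simp add: pderiv_mult del: mult_pCons_left)
    then have "of_nat n * x ^ (n - 1) = 0" by (simp add: q_def pderiv_diff pderiv_monom poly_monom)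
    then have "x = 0" using assms by simp
    moreover have "x ^ n = 1" using that roots by blast
    ultimately show False using assms by (simp add: power_0_left)
  qed
  then have "size A = card (set_mset A)" by (simp add: size_multiset_overloaded_eq)
  then show ?thesis using A(1) roots by simp
qed

lemma finite_roots_of_unity:
  "n > 0 \<Longrightarrow> finite {w :: 'a::{alg_closed_field, field_char_0}. w ^ n = 1}"
  using card_roots_of_unity[of n, where 'a='a] card_ge_0_finite by force

lemma power_int_gcd_eq_1:
  fixes w :: "'a::field"
  assumes "w \<noteq> 0" "w powi a = 1" "w powi b = 1"
  shows "w powi (gcd a b) = 1"
proof -
  obtain x y where "gcd a b = x * a + y * b" using bezout_int[of a b] by metis
  then have "w powi (gcd a b) = (w powi a) powi x * (w powi b) powi y"
    using assms(1) by (simp add: power_int_add mult.commute[of x] mult.commute[of y] power_int_mult)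
  then show ?thesis using assms by simp
qed

lemma power_int_dvd_eq_1: "w ^ d = 1 \<Longrightarrow> int d dvd j \<Longrightarrow> w powi j = 1" for w :: "'a::field"
  by (auto simp: power_int_mult elim!: dvdE)

section \<open>Polynomially parametrized lines\<close>

lemma subring_range: "ring_map h \<Longrightarrow> subring_set (range h)"
proof -
  assume "ring_map h"
  then interpret ring_map h .
  show ?thesis
    by unfold_locales (auto simp flip: map_1 map_diff map_mult intro!: rangeI)
qed

text \<open>Splitting off a factor \<open>Y - y0\<close> reduces the degree; the values of the
  quotient are again in \<open>S\<close>, because \<open>y - y0\<close> is an invertible constant.
  The exceptional set \<open>B\<close> grows by \<open>y0\<close> at each such step.\<close>

lemma polys_in_interpolate:
  fixes Q :: "'a::field_char_0 fls poly"
  assumes "subring_set S" and const: "\<And>c. fls_const c \<in> S"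
    and "finite B" and "\<And>y. y \<notin> B \<Longrightarrow> poly Q (fls_const y) \<in> S"
  shows "Q \<in> polys_in S"
  using assms(3,4)
proof (induction "degree Q" arbitrary: Q B)
  case 0
  interpret subring_set S by fact
  obtain c where c: "Q = [:c:]" using 0(1) by (metis degree_0_id)
  obtain y where "y \<notin> B" using ex_new_if_finite[OF infinite_UNIV_char_0 0(2)] by blast
  then show ?case using 0(3)[of y] c by simp
next
  case (Suc k)
  interpret subring_set S by fact
  interpret P: subring_set "polys_in S" by (rule subring_polys_in)
  interpret K: ring_map "fls_const :: 'a \<Rightarrow> _" by (rule ring_map_fls_const)
  obtain y0 where y0: "y0 \<notin> B" using ex_new_if_finite[OF infinite_UNIV_char_0 Suc.prems(1)] by blast
  define Q1 where "Q1 = synthetic_div Q (fls_const y0)"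
  have Q: "Q = [:- fls_const y0, 1:] * Q1 + [:poly Q (fls_const y0):]"
    unfolding Q1_def by (rule synthetic_div_correct'[symmetric])
  have "Q1 \<in> polys_in S"
  proof (rule Suc.hyps(1))
    show "k = degree Q1" using Suc.hyps(2) by (simp add: Q1_def degree_synthetic_div)
    show "finite (insert y0 B)" using Suc.prems by simp
    fix y assume y: "y \<notin> insert y0 B"
    have "poly Q (fls_const y) = fls_const (y - y0) * poly Q1 (fls_const y) + poly Q (fls_const y0)"
      by (subst Q) (simp add: algebra_simps)
    then have "fls_const (inverse (y - y0)) * (poly Q (fls_const y) - poly Q (fls_const y0))
        = fls_const (inverse (y - y0)) * fls_const (y - y0) * poly Q1 (fls_const y)" by simp
    also have "fls_const (inverse (y - y0)) * fls_const (y - y0) = 1"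
      using y by (simp add: fls_const_mult_const del: K.map_diff)
    finally show "poly Q1 (fls_const y) \<in> S"
      using Suc.prems(2)[of y] Suc.prems(2)[OF y0] y const by (metis diff_in insertCI mult_1 mult_in)
  qed
  then show ?case
    using Suc.prems(2)[OF y0] const by (subst Q) (intro P.add_in P.mult_in, auto)
qed

text \<open>The projection onto \<open>k((\<tau> ^ d))\<close>; it agrees with \<open>x\<close>
  below the first exponent of \<open>x\<close> that is not divisible by \<open>d\<close>.\<close>

definition truncate_dvd :: "nat \<Rightarrow> 'a::zero fls \<Rightarrow> 'a fls" where
  "truncate_dvd d x = Abs_fls (\<lambda>j. if int d dvd j then x $$ j else 0)"

lemma truncate_dvd_nth: "truncate_dvd d x $$ j = (if int d dvd j then x $$ j else 0)"
  unfolding truncate_dvd_def by (subst nth_Abs_fls_lower_bound[of "fls_subdegree x"]) auto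

text \<open>By \<open>p_fg\<close>, which reads \<open>p(f(t), g(t)) = t\<close>, the polynomials
  \<open>f\<close> and \<open>g\<close> generate \<open>k[t]\<close>.\<close>

locale line_parametrization =
  fixes f g :: "'a::{alg_closed_field, field_char_0} poly" and p :: "'a poly poly" and \<theta> :: "'a fls"
  assumes deg_pos: "degree f > 0" "degree g > 0"
    and sub_\<theta>: "fls_subdegree \<theta> = -1"
    and f_\<theta>: "eval_fls f \<theta> = fls_X_intpow (- int (degree f))"
    and p_fg: "poly (map_poly (\<lambda>c. pcompose c f) p) g = [:0, 1:]"
begin

abbreviation "n \<equiv> degree f"
text \<open>Under \<open>t = \<theta>(\<tau>)\<close> the polynomials \<open>f\<close> and
  \<open>g\<close> become \<xi> and \<gamma>, and the rings \<open>k[f]\<close> and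
  \<open>k[t]\<close> become \<open>S\<close> and \<open>T\<close>. The ring \<open>L0\<close> is
  \<open>k((\<tau> ^ n))\<close>, the fixed field of the twists.\<close>

definition "\<xi> = (fls_X_intpow (- int n) :: 'a fls)"
definition "\<gamma> = eval_fls g \<theta>"
definition "S = range (\<lambda>q. eval_fls q \<xi>)"
definition "T = range (\<lambda>q. eval_fls q \<theta>)"
definition "roots d = {w :: 'a. w ^ d = 1}"
abbreviation "\<Omega> \<equiv> roots n"
definition "L0 = {x. \<forall>w\<in>\<Omega>. twist w x = x}"

lemma roots_nonzero: "w \<in> roots d \<Longrightarrow> d > 0 \<Longrightarrow> w \<noteq> 0"
  by (auto simp: roots_def power_0_left)

lemma \<Omega>_nonzero: "w \<in> \<Omega> \<Longrightarrow> w \<noteq> 0"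
  using deg_pos roots_nonzero by blast

lemma finite_roots: "d > 0 \<Longrightarrow> finite (roots d)" and card_roots: "d > 0 \<Longrightarrow> card (roots d) = d"
  unfolding roots_def by (simp_all add: finite_roots_of_unity card_roots_of_unity)

lemma finite_\<Omega>: "finite \<Omega>" and card_\<Omega>: "card \<Omega> = n"
  using deg_pos by (simp_all add: finite_roots card_roots)

lemma roots_mult: "v \<in> roots d \<Longrightarrow> w \<in> roots d \<Longrightarrow> v * w \<in> roots d"
  and roots_inverse: "w \<in> roots d \<Longrightarrow> inverse w \<in> roots d"
  and roots_1: "1 \<in> roots d"
  by (auto simp: roots_def power_mult_distrib power_inverse)

lemma roots_dvd: "d dvd d' \<Longrightarrow> roots d \<subseteq> roots d'"
  by (auto simp: roots_def power_mult)

lemma ring_map_eval_fls: "ring_map (\<lambda>q. eval_fls q x)" for x :: "'a fls"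
  by (intro ring_map.ring_map_poly_map_poly ring_map_fls_const)

sublocale S: subring_set S unfolding S_def by (intro subring_range ring_map_eval_fls)
sublocale T: subring_set T unfolding T_def by (intro subring_range ring_map_eval_fls)
sublocale PS: subring_set "polys_in S" by (rule S.subring_polys_in)

lemma twist_ring: "w \<in> \<Omega> \<Longrightarrow> ring_map (twist w)"
  by (intro ring_map_twist \<Omega>_nonzero)

lemma subring_L0: "subring_set L0"
proof
  have *: "ring_map (twist w)" if "w \<in> \<Omega>" for w using that by (rule twist_ring)
  show "1 \<in> L0" using ring_map.map_1[OF *] by (simp add: L0_def)
  show "x - y \<in> L0" if "x \<in> L0" "y \<in> L0" for x y
    using that ring_map.map_diff[OF *] by (simp add: L0_def)
  show "x * y \<in> L0" if "x \<in> L0" "y \<in> L0" for x y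
    using that ring_map.map_mult[OF *] by (simp add: L0_def)
qed

lemma eval_in:
  assumes "subring_set C" "\<And>c. fls_const c \<in> C" "x \<in> C"
  shows "eval_fls q x \<in> C"
  using assms by (intro subring_set.poly_in) (auto simp: polys_in_def coeff_map_poly)

lemma const_in: "fls_const c \<in> S" "fls_const c \<in> T" "fls_const c \<in> L0"
proof -
  show "fls_const c \<in> S" "fls_const c \<in> T"
    using rangeI[of "\<lambda>q. eval_fls q \<xi>" "[:c:]"] rangeI[of "\<lambda>q. eval_fls q \<theta>" "[:c:]"]
    by (auto simp: S_def T_def map_poly_pCons)
  show "fls_const c \<in> L0" by (simp add: L0_def \<Omega>_nonzero)
qed

lemma \<xi>_in: "\<xi> \<in> S" and \<theta>_in: "\<theta> \<in> T"
  using rangeI[of "\<lambda>q. eval_fls q \<xi>" "[:0,1:]"] rangeI[of "\<lambda>q. eval_fls q \<theta>" "[:0,1:]"]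
  by (auto simp: S_def T_def map_poly_pCons)

lemma \<gamma>_in: "\<gamma> \<in> T"
  by (auto simp: \<gamma>_def T_def)

lemma \<xi>_eq: "\<xi> = eval_fls f \<theta>"
  by (simp add: \<xi>_def f_\<theta>)

lemma S_subset_T: "S \<subseteq> T"
  unfolding S_def \<xi>_eq by (auto intro!: eval_in T.subring_set_axioms const_in \<theta>_in)

lemma \<xi>_in_L0: "\<xi> \<in> L0"
  unfolding L0_def \<xi>_def
proof (intro CollectI ballI twist_X_intpow)
  fix w assume w: "w \<in> \<Omega>"
  then show "w \<noteq> 0" by (rule \<Omega>_nonzero)
  show "w powi - int n = 1" using w by (intro power_int_dvd_eq_1[of w n]) (auto simp: roots_def)
qed

lemma S_subset_L0: "S \<subseteq> L0"
  unfolding S_def using \<xi>_in_L0 by (auto intro!: eval_in subring_L0 const_in)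

text \<open>A nonzero polynomial in \<open>t\<close> has nonnegative degree. Both final inequalities
  rest on this fact.\<close>

lemma subdegree_T: "x \<in> T \<Longrightarrow> x \<noteq> 0 \<Longrightarrow> fls_subdegree x \<le> 0"
proof -
  assume "x \<in> T" "x \<noteq> 0"
  then obtain q where q: "x = eval_fls q \<theta>" unfolding T_def by blast
  with \<open>x \<noteq> 0\<close> have q0: "q \<noteq> 0" by auto
  show ?thesis unfolding q fls_subdegree_eval_fls[OF sub_\<theta> q0] by simp
qed

section \<open>Conjugates of the parametrization, and norms\<close>

definition "pS = map_poly (\<lambda>c. eval_fls c \<xi>) p"

lemma pS_in: "pS \<in> polys_in S"
  unfolding pS_def polys_in_def by (auto simp: coeff_map_poly S_def)

lemma pS_\<gamma>: "poly pS \<gamma> = \<theta>"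
proof -
  interpret h: ring_map "\<lambda>q. eval_fls q \<theta>" by (rule ring_map_eval_fls)
  interpret K: ring_map "fls_const :: 'a \<Rightarrow> _" by (rule ring_map_fls_const)
  have "map_poly (\<lambda>q. eval_fls q \<theta>) (map_poly (\<lambda>c. pcompose c f) p) = pS"
    unfolding pS_def
    by (rule poly_eqI) (simp add: coeff_map_poly K.map_poly_pcompose poly_pcompose \<xi>_eq)
  then have "poly pS \<gamma> = eval_fls [:0, 1:] \<theta>"
    using h.poly_map_poly[of "map_poly (\<lambda>c. pcompose c f) p" g] by (simp only: \<gamma>_def p_fg)
  then show ?thesis by simp
qed

lemma poly_twist:
  assumes "A \<in> polys_in L0" "w \<in> \<Omega>"
  shows "poly A (twist w x) = twist w (poly A x)"
proof -
  interpret t: ring_map "twist w" using assms(2) by (rule twist_ring)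
  have "map_poly (twist w) A = A"
    using assms by (intro poly_eqI) (simp add: polys_in_def L0_def)
  then show ?thesis using t.poly_map_poly[of A x] by (simp only:)
qed

lemma twist_\<theta>_eq: 
  assumes "w \<noteq> 0" "v \<noteq> 0" "twist w \<theta> = twist v \<theta>" shows "w = v"
proof -
  have "\<theta> $$ -1 \<noteq> 0"
    using sub_\<theta> by (metis fls_zero_subdegree nth_fls_subdegree_nonzero zero_neq_neg_one)
  moreover have "\<theta> $$ -1 * w powi -1 = \<theta> $$ -1 * v powi -1"
    using arg_cong[OF assms(3), of "\<lambda>x. x $$ -1"]
    by (simp only: twist_nth[OF assms(1)] twist_nth[OF assms(2)])
  ultimately show ?thesis using assms by (simp add: power_int_minus)
qed

lemma inj_twist_\<theta>: "inj_on (\<lambda>w. twist w \<theta>) \<Omega>"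
  by (intro inj_onI twist_\<theta>_eq \<Omega>_nonzero)

text \<open>As \<theta> is a polynomial in \<gamma> with coefficients fixed by the twists, equal
  conjugates of \<gamma> give equal conjugates of \<theta>, and these differ already in their
  leading coefficients.\<close>

lemma inj_twist_\<gamma>: "inj_on (\<lambda>w. twist w \<gamma>) \<Omega>"
proof (rule inj_onI)
  fix w v assume wv: "w \<in> \<Omega>" "v \<in> \<Omega>" "twist w \<gamma> = twist v \<gamma>"
  have "pS \<in> polys_in L0" using pS_in polys_in_mono[OF S_subset_L0] by blast
  then have "twist w \<theta> = twist v \<theta>" using wv poly_twist[of pS] pS_\<gamma> by metis
  then show "w = v" using wv by (intro twist_\<theta>_eq \<Omega>_nonzero)
qed

text \<open>Such an \<open>A\<close> vanishes at all \<open>n\<close> distinct conjugates of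
  \<gamma>: the degree of \<gamma> over \<open>S\<close> is not below \<open>n\<close>.\<close>

lemma vanish:
  assumes A: "A \<in> polys_in S" "deg_lt A n" "poly A \<gamma> = 0"
  shows "A = 0"
proof (rule ccontr)
  assume "A \<noteq> 0"
  have A': "A \<in> polys_in L0" using A(1) polys_in_mono[OF S_subset_L0] by blast
  have "A = 0"
  proof (rule poly_eqI_degree[of "(\<lambda>w. twist w \<gamma>) ` \<Omega>"])
    show "poly A x = poly 0 x" if "x \<in> (\<lambda>w. twist w \<gamma>) ` \<Omega>" for x
      using that A(3) poly_twist[OF A'] \<Omega>_nonzero by auto
  qed (use \<open>A \<noteq> 0\<close> A(2) card_image[OF inj_twist_\<gamma>] card_\<Omega> deg_pos in \<open>auto simp: deg_lt_def\<close>)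
  with \<open>A \<noteq> 0\<close> show False by simp
qed

text \<open>The conjugates of \<theta> are \<open>n\<close> distinct roots of the left side, because
  twisting fixes \<xi>.\<close>

lemma f_factor: "lift_poly f - [:\<xi>:] = smult (fls_const (lead_coeff f)) (\<Prod>w\<in>\<Omega>. [:- twist w \<theta>, 1:])"
proof -
  define A where "A = lift_poly f - [:\<xi>:] - smult (fls_const (lead_coeff f)) (\<Prod>w\<in>\<Omega>. [:- twist w \<theta>, 1:])"
  define M where "M = (\<Prod>w\<in>\<Omega>. [:- twist w \<theta>, 1:])"
  have M: "degree M = n" "lead_coeff M = 1"
  proof -
    show "degree M = n" unfolding M_def using finite_\<Omega> card_\<Omega> by (subst degree_prod_sum_eq) auto
    show "lead_coeff M = 1" unfolding M_def by (simp add: lead_coeff_prod)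
  qed
  have "deg_lt A n"
    unfolding deg_lt_iff_coeff
  proof (intro allI impI)
    fix i assume "n \<le> i"
    then show "coeff A i = 0"
      using M deg_pos coeff_eq_0[of f i] coeff_eq_0[of M i]
      by (cases "i = n") (auto simp: A_def coeff_map_poly coeff_pCons simp flip: M_def split: nat.splits)
  qed
  have "A = 0"
  proof (rule ccontr)
    assume "A \<noteq> 0"
    have "A = 0"
    proof (rule poly_eqI_degree[of "(\<lambda>w. twist w \<theta>) ` \<Omega>"])
      show "poly A x = poly 0 x" if "x \<in> (\<lambda>w. twist w \<theta>) ` \<Omega>" for x
      proof -
        from that obtain w where w: "w \<in> \<Omega>" "x = twist w \<theta>" by blast
        have "eval_fls f x = \<xi>"
          using w \<xi>_in_L0 twist_eval_fls[OF \<Omega>_nonzero[OF w(1)], of f \<theta>] by (simp add: \<xi>_eq L0_def)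
        moreover have "(\<Prod>w\<in>\<Omega>. x - twist w \<theta>) = 0" using w finite_\<Omega> by auto
        ultimately show ?thesis by (simp add: A_def poly_prod)
      qed
    qed (use \<open>A \<noteq> 0\<close> \<open>deg_lt A n\<close> card_image[OF inj_twist_\<theta>] card_\<Omega> deg_pos in \<open>auto simp: deg_lt_def\<close>)
    with \<open>A \<noteq> 0\<close> show False by simp
  qed
  then show ?thesis by (simp add: A_def)
qed

text \<open>Evaluating \<open>f_factor\<close> at the constant \<open>c\<close> gives this norm, up
  to sign and the leading coefficient of \<open>f\<close>, as \<open>f(c) - \<xi>\<close>.\<close>

lemma norm_linear_in: "(\<Prod>w\<in>\<Omega>. twist w \<theta> - fls_const c) \<in> S"
proof -
  interpret K: ring_map "fls_const :: 'a \<Rightarrow> _" by (rule ring_map_fls_const)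
  have "f \<noteq> 0" using deg_pos by auto
  have "eval_fls f (fls_const c) - \<xi> = fls_const (lead_coeff f) * (\<Prod>w\<in>\<Omega>. fls_const c - twist w \<theta>)"
    using arg_cong[OF f_factor, of "\<lambda>q. poly q (fls_const c)"] by (simp add: poly_prod)
  then have "fls_const (1 / lead_coeff f) * (eval_fls f (fls_const c) - \<xi>)
    = fls_const (1 / lead_coeff f) * fls_const (lead_coeff f) * (\<Prod>w\<in>\<Omega>. fls_const c - twist w \<theta>)" by simp
  also have "fls_const (1 / lead_coeff f) * fls_const (lead_coeff f) = 1"
    using \<open>f \<noteq> 0\<close> by (simp flip: K.map_mult)
  finally have "(\<Prod>w\<in>\<Omega>. fls_const c - twist w \<theta>) = fls_const (1 / lead_coeff f) * (eval_fls f (fls_const c) - \<xi>)"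
    by simp
  moreover have "\<dots> \<in> S"
    by (intro S.mult_in S.diff_in \<xi>_in const_in eval_in S.subring_set_axioms)
  ultimately have "(\<Prod>w\<in>\<Omega>. fls_const c - twist w \<theta>) \<in> S" by simp
  moreover have "(\<Prod>w\<in>\<Omega>. twist w \<theta> - fls_const c) = (-1) ^ n * (\<Prod>w\<in>\<Omega>. fls_const c - twist w \<theta>)"
  proof -
    have "(\<Prod>w\<in>\<Omega>. twist w \<theta> - fls_const c) = (\<Prod>w\<in>\<Omega>. (-1) * (fls_const c - twist w \<theta>))"
      by (intro prod.cong) auto
    also have "\<dots> = (-1) ^ card \<Omega> * (\<Prod>w\<in>\<Omega>. fls_const c - twist w \<theta>)"
      unfolding prod.distrib by simp
    finally show ?thesis by (simp add: card_\<Omega>)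
  qed
  ultimately show ?thesis by (auto intro!: S.mult_in S.power_in S.uminus_in)
qed

text \<open>Norms are multiplicative and \<open>q\<close> splits into linear factors, so the linear
  case suffices.\<close>

lemma norm_in: "(\<Prod>w\<in>\<Omega>. eval_fls q (twist w \<theta>)) \<in> S"
proof (induction "degree q" arbitrary: q)
  case 0
  then obtain c where "q = [:c:]" by (metis degree_0_id)
  then show ?case by (auto simp: map_poly_pCons intro!: S.prod_in const_in)
next
  case (Suc k)
  interpret K: ring_map "fls_const :: 'a \<Rightarrow> _" by (rule ring_map_fls_const)
  interpret LK: ring_map "lift_poly :: 'a poly \<Rightarrow> _" by (rule K.ring_map_map_poly)
  obtain c where "poly q c = 0" using alg_closed_imp_poly_has_root[of q] Suc(2) by auto
  then obtain q' where q': "q = [:-c, 1:] * q'" by (metis dvdE poly_eq_0_iff_dvd)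
  then have "k = degree q'" using Suc(2) by (cases "q' = 0") (simp_all add: degree_mult_eq del: mult_pCons_left)
  then have "(\<Prod>w\<in>\<Omega>. eval_fls q' (twist w \<theta>)) \<in> S" by (rule Suc.hyps)
  moreover have "eval_fls q x = (x - fls_const c) * eval_fls q' x" for x
    unfolding q' by (simp only: LK.map_mult poly_mult) simp
  ultimately show ?case using norm_linear_in by (simp add: prod.distrib S.mult_in)
qed

section \<open>The equation of the curve\<close>

definition "F = (\<Prod>w\<in>\<Omega>. [:- twist w \<gamma>, 1:])"

text \<open>For a constant \<open>y\<close>, the value of \<open>F\<close> is the norm of
  \<open>y - g(\<theta>)\<close>, hence in \<open>S\<close>; interpolation passes from values to
  coefficients.\<close>

lemma F_in: "F \<in> polys_in S"
proof (rule polys_in_interpolate[of S "{}"])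
  interpret K: ring_map "fls_const :: 'a \<Rightarrow> _" by (rule ring_map_fls_const)
  interpret LK: ring_map "lift_poly :: 'a poly \<Rightarrow> _" by (rule K.ring_map_map_poly)
  fix y
  have "poly F (fls_const y) = (\<Prod>w\<in>\<Omega>. eval_fls ([:y:] - g) (twist w \<theta>))"
    unfolding F_def poly_prod
  proof (rule prod.cong[OF refl])
    fix w assume "w \<in> \<Omega>"
    then have "twist w \<gamma> = eval_fls g (twist w \<theta>)"
      unfolding \<gamma>_def by (intro twist_eval_fls \<Omega>_nonzero)
    then show "poly [:- twist w \<gamma>, 1:] (fls_const y) = eval_fls ([:y:] - g) (twist w \<theta>)"
      by (simp only: LK.map_diff poly_diff) simp
  qed
  then show "poly F (fls_const y) \<in> S" using norm_in[of "[:y:] - g"] by (simp only:)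
qed (auto intro: S.subring_set_axioms const_in)

lemma F_monic: "degree F = n" "lead_coeff F = 1"
proof -
  show "degree F = n" unfolding F_def using finite_\<Omega> card_\<Omega> by (subst degree_prod_sum_eq) auto
  show "lead_coeff F = 1" unfolding F_def by (simp add: lead_coeff_prod)
qed

text \<open>Thus \<open>F\<close> generates the kernel of evaluation at \<gamma> on polynomials over
  \<open>S\<close>. The remainder modulo \<open>F\<close> is zero by \<open>vanish\<close>.\<close>

lemma F_dvd:
  assumes "A \<in> polys_in S" "poly A \<gamma> = 0"
  shows "\<exists>B\<in>polys_in S. A = B * F"
proof -
  obtain Q R where QR: "Q \<in> polys_in S" "R \<in> polys_in S" "A = Q * F + R" "R = 0 \<or> degree R < degree F"
    using S.monic_division_in[OF F_in F_monic(2) assms(1)] by blast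
  have "poly F \<gamma> = 0"
    unfolding F_def poly_prod using finite_\<Omega> roots_1[of n] by (intro prod_zero) (auto intro!: bexI[of _ 1])
  then have "poly R \<gamma> = 0" using assms(2) QR by simp
  then have "R = 0" using QR F_monic by (intro vanish) (auto simp: deg_lt_def)
  then show ?thesis using QR by auto
qed

section \<open>The lower bound from smoothness\<close>

definition "\<delta> w = fls_subdegree (\<gamma> - twist w \<gamma>)"

lemma \<gamma>_diff_nonzero: "w \<in> \<Omega> - {1} \<Longrightarrow> \<gamma> - twist w \<gamma> \<noteq> 0"
  using inj_onD[OF inj_twist_\<gamma>, of w 1] roots_1 by auto

text \<open>Differentiating \<open>f(p) - \<xi> = A F\<close> and \<open>Y - g(p) = B F\<close> in \<open>Y\<close> at the generic point of the curve
  \<open>F = 0\<close> shows that \<open>\<partial>F/\<partial>Y\<close> divides \<open>f'\<close> there.\<close>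

lemma different_dvd: "\<exists>t\<in>T. poly (pderiv F) \<gamma> * t = eval_fls (pderiv f) \<theta>"
proof -
  interpret K: ring_map "fls_const :: 'a \<Rightarrow> _" by (rule ring_map_fls_const)
  have lift_in: "lift_poly q \<in> polys_in S" for q by (auto simp: polys_in_def const_in)
  have pd: "pderiv (lift_poly q) = lift_poly (pderiv q)" for q :: "'a poly"
    by (rule poly_eqI) (simp add: coeff_pderiv fls_of_nat flip: fls_const_mult_const)
  have F0: "poly F \<gamma> = 0"
    unfolding F_def poly_prod using finite_\<Omega> roots_1[of n] by (intro prod_zero) (auto intro!: bexI[of _ 1])
  define p' where "p' = poly (pderiv pS) \<gamma>"
  define \<phi> where "\<phi> = poly (pderiv F) \<gamma>"
  have "\<exists>A\<in>polys_in S. pcompose (lift_poly f) pS - [:\<xi>:] = A * F"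
    using \<xi>_in by (intro F_dvd PS.diff_in S.pcompose_in lift_in pS_in)
      (auto simp: poly_pcompose pS_\<gamma> \<xi>_eq)
  then obtain A where A: "A \<in> polys_in S" "pcompose (lift_poly f) pS - [:\<xi>:] = A * F" by blast
  have "\<exists>B\<in>polys_in S. [:0, 1:] - pcompose (lift_poly g) pS = B * F"
    by (intro F_dvd PS.diff_in S.pcompose_in lift_in pS_in)
      (auto simp: poly_pcompose pS_\<gamma> simp flip: \<gamma>_def)
  then obtain B where B: "B \<in> polys_in S" "[:0, 1:] - pcompose (lift_poly g) pS = B * F" by blast
  have 1: "eval_fls (pderiv f) \<theta> * p' = poly A \<gamma> * \<phi>"
    using arg_cong[OF A(2), of "\<lambda>q. poly (pderiv q) \<gamma>"] F0
    by (simp add: pderiv_diff pderiv_mult pderiv_pcompose poly_pcompose pS_\<gamma> p'_def \<phi>_def pd pderiv_pCons)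
  have 2: "1 - eval_fls (pderiv g) \<theta> * p' = poly B \<gamma> * \<phi>"
    using arg_cong[OF B(2), of "\<lambda>q. poly (pderiv q) \<gamma>"] F0
    by (simp add: pderiv_diff pderiv_mult pderiv_pcompose poly_pcompose pS_\<gamma> p'_def \<phi>_def pd pderiv_pCons)
  \<comment> \<open>This combination eliminates \<open>p'\<close>, the derivative of
    \<open>pS\<close> at \<gamma>, from the two relations.\<close>
  define t where "t = poly A \<gamma> * eval_fls (pderiv g) \<theta> + eval_fls (pderiv f) \<theta> * poly B \<gamma>"
  have "\<phi> * t = eval_fls (pderiv g) \<theta> * (poly A \<gamma> * \<phi>) + eval_fls (pderiv f) \<theta> * (poly B \<gamma> * \<phi>)"
    by (simp add: t_def algebra_simps)
  also have "\<dots> = eval_fls (pderiv f) \<theta>"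
    unfolding 1[symmetric] 2[symmetric] by (simp add: algebra_simps)
  finally have "\<phi> * t = eval_fls (pderiv f) \<theta>" .
  moreover have "t \<in> T"
    unfolding t_def using A(1) B(1) polys_in_mono[OF S_subset_T] \<gamma>_in
    by (intro T.add_in T.mult_in T.poly_in[of A] T.poly_in[of B] eval_in T.subring_set_axioms)
      (auto intro: const_in \<theta>_in)
  ultimately show ?thesis by (auto simp: \<phi>_def)
qed

text \<open>The sum is the order of the derivative of \<open>F\<close> at \<gamma>. Its product with
  an element of \<open>T\<close>, of order at most 0, is \<open>f'\<close> at \<theta>, of order
  \<open>- (n - 1)\<close>.\<close>

lemma sum_\<delta>_ge: "- (int n - 1) \<le> (\<Sum>w\<in>\<Omega>-{1}. \<delta> w)"
proof -
  define H where "H = (\<Prod>w\<in>\<Omega>-{1}. [:- twist w \<gamma>, 1:])"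
  have "F = [:- \<gamma>, 1:] * H"
    unfolding F_def H_def using prod.remove[OF finite_\<Omega> roots_1, of "\<lambda>w. [:- twist w \<gamma>, 1:]"]
    by (simp only: twist_1)
  then have "poly (pderiv F) \<gamma> = poly H \<gamma>"
    by (simp add: pderiv_mult pderiv_pCons del: mult_pCons_left)
  also have "\<dots> = (\<Prod>w\<in>\<Omega>-{1}. \<gamma> - twist w \<gamma>)" by (simp add: H_def poly_prod)
  finally have eq: "poly (pderiv F) \<gamma> = (\<Prod>w\<in>\<Omega>-{1}. \<gamma> - twist w \<gamma>)" .
  have sub: "fls_subdegree (poly (pderiv F) \<gamma>) = (\<Sum>w\<in>\<Omega>-{1}. \<delta> w)"
    unfolding eq \<delta>_def using \<gamma>_diff_nonzero by (intro fls_subdegree_prod) auto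
  obtain t where t: "t \<in> T" "poly (pderiv F) \<gamma> * t = eval_fls (pderiv f) \<theta>"
    using different_dvd by blast
  have pf: "pderiv f \<noteq> 0" using deg_pos by (simp add: pderiv_eq_0_iff)
  have f': "fls_subdegree (eval_fls (pderiv f) \<theta>) = - (int n - 1)"
    using fls_subdegree_eval_fls[OF sub_\<theta> pf] deg_pos by (simp add: degree_pderiv of_nat_diff)
  have "eval_fls (pderiv f) \<theta> \<noteq> 0"
    using subdegree_eval_fls(2)[OF sub_\<theta> pf] by (metis fls_zero_nth)
  then have "poly (pderiv F) \<gamma> \<noteq> 0" "t \<noteq> 0" using t(2) by auto
  then have "(\<Sum>w\<in>\<Omega>-{1}. \<delta> w) + fls_subdegree t = - (int n - 1)"
    using sub f' t(2) fls_subdegree_mult by metis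
  moreover have "fls_subdegree t \<le> 0" using t(1) \<open>t \<noteq> 0\<close> by (rule subdegree_T)
  ultimately show ?thesis by linarith
qed

lemma prod_conj_in_L0:
  assumes "finite U" and bij: "\<And>w. w \<in> \<Omega> \<Longrightarrow> bij_betw (twist w) U U"
  shows "(\<Prod>v\<in>U. [:- v, 1:]) \<in> polys_in L0"
proof -
  let ?G = "\<Prod>v\<in>U. [:- v, 1:]"
  have "twist w (coeff ?G i) = coeff ?G i" if w: "w \<in> \<Omega>" for w i
  proof -
    interpret t: ring_map "twist w" using w by (rule twist_ring)
    interpret P: ring_map "map_poly (twist w)" by (rule t.ring_map_map_poly)
    have "map_poly (twist w) ?G = (\<Prod>v\<in>U. [:- twist w v, 1:])" by (simp add: P.map_prod)
    also have "\<dots> = ?G" using bij[OF w] by (rule prod.reindex_bij_betw)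
    finally show ?thesis by (metis t.coeff_map_poly')
  qed
  then show ?thesis by (simp add: polys_in_def L0_def)
qed

lemma twist_truncate: "w \<in> roots d \<Longrightarrow> d > 0 \<Longrightarrow> twist w (truncate_dvd d x) = truncate_dvd d x"
  by (rule fls_eqI)
    (auto simp: twist_nth roots_nonzero truncate_dvd_nth roots_def power_int_dvd_eq_1)

section \<open>Characteristic divisors and the upper bound\<close>

definition "rest d = \<gamma> - truncate_dvd d \<gamma>"

text \<open>For \<open>w\<close> outside \<open>roots d\<close>, the conjugates \<gamma> and
  \<open>twist w \<gamma>\<close> already differ before \<open>rest d\<close> begins, so the
  truncated series shows the same order of difference.\<close>

definition "separated d \<longleftrightarrow> (\<forall>w\<in>\<Omega> - roots d. ord_ge (\<delta> w + 1) (rest d))"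

text \<open>The bound is \<open>d\<close> times the order at the curve of an approximate root of \<open>F\<close>, which is a
  polynomial in the parameter.\<close>

lemma level_nonpos:
  assumes d: "d dvd n" "d > 1" and nz: "rest d \<noteq> 0" and sep: "separated d"
  shows "int d * fls_subdegree (rest d) + (\<Sum>w\<in>\<Omega> - roots d. \<delta> w) \<le> 0"
proof -
  define u where "u = truncate_dvd d \<gamma>"
  define r where "r = rest d"
  define \<rho> where "\<rho> = fls_subdegree r"
  define U where "U = (\<lambda>w. twist w u) ` \<Omega>"
  have \<gamma>: "\<gamma> = u + r" by (simp add: u_def r_def rest_def)
  have r0: "r \<noteq> 0" using nz by (simp add: r_def)
  have finU: "finite U" using finite_\<Omega> by (simp add: U_def)
  have u_in: "u \<in> U" using roots_1[of n] by (auto simp: U_def intro!: image_eqI[of _ _ 1])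
  have roots_sub: "roots d \<subseteq> \<Omega>" using d(1) by (rule roots_dvd)
  have fix_u: "twist w u = u" if "w \<in> roots d" for w
    unfolding u_def using that d by (intro twist_truncate) auto
  have \<delta>_less: "\<delta> w < \<rho>" if "w \<in> \<Omega> - roots d" for w
  proof -
    have "ord_ge (\<delta> w + 1) r" using sep that by (simp add: separated_def r_def)
    then show ?thesis using r0 by (simp add: ord_ge_iff_subdegree \<rho>_def)
  qed
  \<comment> \<open>Passing from \<gamma> to \<open>u\<close> alters the difference only in orders
    above \<open>\<delta> w\<close>.\<close>
  have move: "twist w u \<noteq> u \<and> fls_subdegree (u - twist w u) = \<delta> w" if w: "w \<in> \<Omega> - roots d" for w
  proof -
    interpret t: ring_map "twist w" using w by (intro twist_ring) auto
    have w0: "w \<noteq> 0" using w \<Omega>_nonzero by auto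
    have "w \<noteq> 1" using w roots_1 by auto
    then have g0: "\<gamma> - twist w \<gamma> \<noteq> 0" using \<gamma>_diff_nonzero w by auto
    have eq: "u - twist w u = (\<gamma> - twist w \<gamma>) - (r - twist w r)" by (simp add: \<gamma>)
    have r': "ord_ge (\<delta> w + 1) (r - twist w r)"
      using sep w w0 by (intro ord_ge_diff) (auto simp: separated_def r_def ord_ge_twist)
    have "ord_ge (\<delta> w) (u - twist w u)"
      unfolding eq
    proof (rule ord_ge_diff)
      show "ord_ge (\<delta> w) (\<gamma> - twist w \<gamma>)" unfolding \<delta>_def by (rule ord_ge_subdegree)
      show "ord_ge (\<delta> w) (r - twist w r)" using r' by (rule ord_ge_mono) simp
    qed
    moreover have "(u - twist w u) $$ \<delta> w = (\<gamma> - twist w \<gamma>) $$ \<delta> w"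
      using r' unfolding eq by (simp add: ord_ge_def)
    then have "(u - twist w u) $$ \<delta> w \<noteq> 0"
      using g0 unfolding \<delta>_def by (simp only: nth_fls_subdegree_nonzero not_False_eq_True)
    ultimately have "fls_subdegree (u - twist w u) = \<delta> w" by (rule subdegree_eqI_ord_ge)
    moreover have "twist w u \<noteq> u" using \<open>(u - twist w u) $$ \<delta> w \<noteq> 0\<close> by auto
    ultimately show ?thesis by simp
  qed
  \<comment> \<open>The stabilizer of \<open>u\<close> in the group of \<open>n\<close>-th roots of
    unity is exactly \<open>roots d\<close>, so the fibres over \<open>U\<close> are its cosets and
    have \<open>d\<close> elements.\<close>
  have fibre: "{w \<in> \<Omega>. twist w u = twist w0 u} = (\<lambda>h. w0 * h) ` roots d" if w0: "w0 \<in> \<Omega>" for w0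
  proof (intro equalityI subsetI)
    fix w assume "w \<in> {w \<in> \<Omega>. twist w u = twist w0 u}"
    then have w: "w \<in> \<Omega>" "twist w u = twist w0 u" by auto
    note nz = \<Omega>_nonzero[OF w0] \<Omega>_nonzero[OF w(1)]
    have "twist (inverse w0 * w) u = twist (inverse w0) (twist w u)"
      using nz by (simp add: twist_twist)
    also have "\<dots> = u" unfolding w(2) using nz by (simp add: twist_twist)
    finally have "inverse w0 * w \<in> roots d"
      using move w w0 by (metis DiffI roots_inverse roots_mult)
    then show "w \<in> (\<lambda>h. w0 * h) ` roots d"
      using nz by (intro image_eqI[of _ _ "inverse w0 * w"]) auto
  next
    fix w assume "w \<in> (\<lambda>h. w0 * h) ` roots d"
    then obtain h where h: "w = w0 * h" "h \<in> roots d" by auto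
    then have "twist w u = twist w0 (twist h u)"
      using \<Omega>_nonzero roots_sub w0 by (simp add: twist_twist subset_iff)
    then show "w \<in> {w \<in> \<Omega>. twist w u = twist w0 u}"
      using h fix_u roots_sub w0 roots_mult by auto
  qed
  have sum_fibre: "(\<Sum>w\<in>\<Omega>. \<phi> (twist w u)) = int d * (\<Sum>v\<in>U. \<phi> v)" for \<phi> :: "'a fls \<Rightarrow> int"
  proof -
    have "(\<Sum>w\<in>\<Omega>. \<phi> (twist w u)) = (\<Sum>v\<in>U. \<Sum>w\<in>{w \<in> \<Omega>. twist w u = v}. \<phi> (twist w u))"
      unfolding U_def by (rule sum.image_gen[OF finite_\<Omega>])
    also have "\<dots> = (\<Sum>v\<in>U. int d * \<phi> v)"
    proof (rule sum.cong[OF refl])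
      fix v assume "v \<in> U"
      then obtain w0 where w0: "w0 \<in> \<Omega>" "v = twist w0 u" by (auto simp: U_def)
      have "card {w \<in> \<Omega>. twist w u = v} = d"
        unfolding w0(2) fibre[OF w0(1)] using \<Omega>_nonzero[OF w0(1)] d
        by (subst card_image) (auto simp: inj_on_def card_roots)
      then show "(\<Sum>w\<in>{w \<in> \<Omega>. twist w u = v}. \<phi> (twist w u)) = int d * \<phi> v" by simp
    qed
    finally show ?thesis by (simp add: sum_distrib_left)
  qed
  have card_U: "n = d * card U"
  proof -
    have "int n = int d * int (card U)" using sum_fibre[of "\<lambda>_. 1"] card_\<Omega> by simp
    then show ?thesis by (metis of_nat_eq_iff of_nat_mult)
  qed
  have bij: "bij_betw (twist w) U U" if w: "w \<in> \<Omega>" for w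
  proof (rule bij_betw_byWitness[where f' = "twist (inverse w)"])
    note w0 = \<Omega>_nonzero[OF w]
    show "\<forall>a\<in>U. twist (inverse w) (twist w a) = a" "\<forall>a\<in>U. twist w (twist (inverse w) a) = a"
      using w0 by (auto simp: twist_twist)
    have *: "twist v ` U \<subseteq> U" if "v \<in> \<Omega>" for v
    proof
      fix x assume "x \<in> twist v ` U"
      then obtain v' where v': "v' \<in> \<Omega>" "x = twist v (twist v' u)" by (auto simp: U_def)
      then have "x = twist (v * v') u" using that \<Omega>_nonzero by (simp add: twist_twist)
      then show "x \<in> U" using that v' roots_mult by (auto simp: U_def)
    qed
    show "twist w ` U \<subseteq> U" "twist (inverse w) ` U \<subseteq> U" using * w roots_inverse by auto
  qed
  interpret lv: conjugate_level L0 u r U \<rho>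
  proof
    show "1 \<in> L0" "\<And>x y. x \<in> L0 \<Longrightarrow> y \<in> L0 \<Longrightarrow> x - y \<in> L0" "\<And>x y. x \<in> L0 \<Longrightarrow> y \<in> L0 \<Longrightarrow> x * y \<in> L0"
      using subring_L0 by (auto simp: subring_set_def)
    show "finite U" "u \<in> U" "r \<noteq> 0" "fls_subdegree r = \<rho>" by (simp_all add: finU u_in r0 \<rho>_def)
    show "(\<Prod>v\<in>U. [:- v, 1:]) \<in> polys_in L0" using finU bij by (rule prod_conj_in_L0)
    fix v assume "v \<in> U"
    then obtain w where w: "w \<in> \<Omega>" "v = twist w u" by (auto simp: U_def)
    have "(\<forall>x\<in>L0. twist w x = x) \<and> (\<forall>x. fls_subdegree (twist w x) = fls_subdegree x)"
      using w(1) \<Omega>_nonzero[OF w(1)] by (simp add: L0_def)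
    then show "\<exists>s. ring_map s \<and> s u = v \<and> bij_betw s U U \<and> (\<forall>x\<in>L0. s x = x)
      \<and> (\<forall>x. fls_subdegree (s x) = fls_subdegree x)"
      using w twist_ring bij by (intro exI[of _ "twist w"]) auto
    assume "v \<noteq> u"
    then have "w \<in> \<Omega> - roots d" using w fix_u by auto
    then show "fls_subdegree (u - v) < \<rho>" using move \<delta>_less w by simp
  qed
  have wu: "lv.w (twist w u) = (if w \<in> roots d then \<rho> else \<delta> w)" if "w \<in> \<Omega>" for w
    using that fix_u move by (auto simp: lv.w_def)
  have sum_eq: "(\<Sum>w\<in>\<Omega>. lv.w (twist w u)) = int d * lv.D" by (simp add: sum_fibre lv.sum_w)
  have F_L0: "F \<in> polys_in L0" using F_in polys_in_mono[OF S_subset_L0] by blast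
  \<comment> \<open>The factors at \<open>twist w \<gamma>\<close> and \<open>twist w u\<close>
    differ by \<open>twist w r\<close>, of order \<rho>, which is at least the order of the latter
    factor. Each conjugate of \<open>u\<close> is counted \<open>d\<close> times.\<close>
  have F_bound: "ord_ge (int d * lv.D) (lv.ev F)"
  proof -
    have "lv.ev F = (\<Prod>w\<in>\<Omega>. lv.ev [:- twist w \<gamma>, 1:])" by (simp only: F_def lv.ev.map_prod)
    moreover have "ord_ge (lv.w (twist w u)) (lv.ev [:- twist w \<gamma>, 1:])" if w: "w \<in> \<Omega>" for w
    proof -
      interpret t: ring_map "twist w" using w by (rule twist_ring)
      have "[:- twist w \<gamma>, 1:] = [:- twist w u, 1:] - [:twist w r:]" by (simp add: \<gamma>)
      then have "lv.ev [:- twist w \<gamma>, 1:] = lv.ev [:- twist w u, 1:] - cst (twist w r)"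
        by (simp only: lv.ev.map_diff lv.ev_const)
      moreover have "ord_ge (lv.w (twist w u)) (cst (twist w r))"
      proof (rule ord_ge_mono)
        show "ord_ge \<rho> (cst (twist w r))"
          using \<Omega>_nonzero[OF w] by (intro lv.ord_ge_cst) (simp add: ord_ge_twist \<rho>_def)
        show "lv.w (twist w u) \<le> \<rho>" using wu[OF w] \<delta>_less[of w] w by (auto intro: less_imp_le)
      qed
      moreover have "ord_ge (lv.w (twist w u)) (lv.ev [:- twist w u, 1:])"
        using w by (intro lv.ord_ge_linear) (auto simp: U_def)
      ultimately show ?thesis by (simp only: ord_ge_diff)
    qed
    ultimately show ?thesis unfolding sum_eq[symmetric] by (simp add: ord_ge_prod)
  qed
  obtain d' where d': "d = Suc d'" "d' > 0" using d(2) by (cases d) auto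
  have "degree F = Suc d' * card U" using card_U F_monic d' by simp
  obtain P where P: "P \<in> polys_in L0" "lead_coeff P = 1" "degree P = card U"
    "deg_lt (F - P ^ Suc d') (d' * card U)" "ord_ge lv.D (poly P (u + r))"
    using lv.approximate_root_bound[OF F_L0 F_monic(2) \<open>degree F = Suc d' * card U\<close>] F_bound const_in(3)
    unfolding d'(1) by blast
  have "1 / of_nat (Suc d') = (fls_const (1 / of_nat (Suc d')) :: 'a fls)"
    by (simp add: fls_of_nat divide_inverse fls_inverse_const del: of_nat_Suc)
  then have "1 / of_nat (Suc d') \<in> S" using const_in(1) by (simp only:)
  then obtain P' where P': "P' \<in> polys_in S" "lead_coeff P' = 1" "degree P' = card U"
    "deg_lt (F - P' ^ Suc d') (d' * card U)"
    using approximate_root_exists_in[OF S.subring_set_axioms _ F_in F_monic(2) \<open>degree F = Suc d' * card U\<close> lv.card_U]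
    by blast
  \<comment> \<open>The root found over \<open>L0\<close> satisfies the order bound, the one found
    over \<open>S\<close> takes a value in \<open>T\<close> at \<gamma>; uniqueness gives one
    polynomial with both properties.\<close>
  have "P' = P" using P P' by (intro approximate_root_unique)
  then have P_in: "P \<in> polys_in S" using P' by simp
  have nzP: "poly P \<gamma> \<noteq> 0"
  proof
    assume "poly P \<gamma> = 0"
    moreover have "card U < n" using card_U d(2) lv.card_U by simp
    ultimately have "P = 0" using P_in P by (intro vanish) (auto simp: deg_lt_def)
    then show False using P by simp
  qed
  have "poly P \<gamma> \<in> T" using P_in polys_in_mono[OF S_subset_T] \<gamma>_in by (intro T.poly_in) auto
  then have "fls_subdegree (poly P \<gamma>) \<le> 0" using nzP by (rule subdegree_T)
  moreover have "lv.D \<le> fls_subdegree (poly P \<gamma>)"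
    using P(5) nzP by (simp add: ord_ge_iff_subdegree \<gamma>)
  ultimately have "lv.D \<le> 0" by simp
  moreover have "int d * lv.D = int d * \<rho> + (\<Sum>w\<in>\<Omega> - roots d. \<delta> w)"
  proof -
    have "int d * lv.D = (\<Sum>w\<in>\<Omega>. if w \<in> roots d then \<rho> else \<delta> w)"
      unfolding sum_eq[symmetric] using wu by (intro sum.cong) auto
    also have "\<dots> = (\<Sum>w\<in>\<Omega> - roots d. if w \<in> roots d then \<rho> else \<delta> w) + (\<Sum>w\<in>roots d. if w \<in> roots d then \<rho> else \<delta> w)"
      using roots_sub finite_\<Omega> by (rule sum.subset_diff)
    also have "\<dots> = (\<Sum>w\<in>\<Omega> - roots d. \<delta> w) + int d * \<rho>"
      using d card_roots[of d] by simp
    finally show ?thesis by simp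
  qed
  moreover have "int d * lv.D \<le> 0" using \<open>lv.D \<le> 0\<close> by (intro mult_nonneg_nonpos) auto
  ultimately show ?thesis by (simp only: \<rho>_def r_def)
qed

text \<open>Descent along the characteristic divisors: the first exponent \<rho> of \<gamma> not
  divisible by \<open>d\<close> leads to \<open>d' = gcd d \<rho>\<close>. The claim for
  \<open>d'\<close> and the bound of \<open>level_nonpos\<close> at \<open>d\<close> combine to the
  claim for \<open>d\<close>; for \<open>d = 1\<close> both sides agree.\<close>

lemma sum_\<delta>_le:
  assumes "d dvd n" "d > 0" "separated d"
  shows "int d * (\<Sum>w\<in>\<Omega>-{1}. \<delta> w) \<le> (\<Sum>w\<in>\<Omega> - roots d. \<delta> w)"
  using assms
proof (induction d rule: less_induct)
  case (less d)
  show ?case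
  proof (cases "d = 1")
    case True
    have "roots 1 = {1}" by (auto simp: roots_def)
    then show ?thesis using True by simp
  next
    case False
    then have d1: "d > 1" using less.prems by simp
    have roots_sub: "roots d \<subseteq> \<Omega>" using less.prems by (intro roots_dvd)
    define \<rho> where "\<rho> = fls_subdegree (rest d)"
    \<comment> \<open>Otherwise a nontrivial root of unity would fix \<gamma>, whose conjugates are
      distinct.\<close>
    have nz: "rest d \<noteq> 0"
    proof
      assume "rest d = 0"
      then have \<gamma>: "\<gamma> = truncate_dvd d \<gamma>" by (simp add: rest_def)
      have "card (roots d) \<noteq> card {1 :: 'a}" using d1 by (simp add: card_roots)
      then obtain w where w: "w \<in> roots d" "w \<noteq> 1" using roots_1[of d] by (metis insertI1 singletonD subsetI subset_antisym insert_subset empty_subsetI)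
      have "twist w \<gamma> = \<gamma>" using twist_truncate[OF w(1) less.prems(2), of \<gamma>] \<gamma> by simp
      then show False using \<gamma>_diff_nonzero[of w] w roots_sub by auto
    qed
    have rho_nz: "rest d $$ \<rho> \<noteq> 0" using nz by (simp add: \<rho>_def)
    then have ndvd: "\<not> int d dvd \<rho>" by (auto simp: rest_def truncate_dvd_nth)
    then have \<gamma>\<rho>: "\<gamma> $$ \<rho> \<noteq> 0" using rho_nz by (simp add: rest_def truncate_dvd_nth)
    define d' where "d' = nat (gcd (int d) \<rho>)"
    have id': "int d' = gcd (int d) \<rho>" by (simp add: d'_def)
    have d'_dvd: "int d' dvd int d" "int d' dvd \<rho>" unfolding id' by auto
    then have d'd: "d' dvd d" by simp
    have d'0: "d' > 0" using less.prems(2) id' by (metis gcd_pos_int of_nat_0_less_iff less_irrefl)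
    have "d' \<noteq> d" using ndvd d'_dvd by metis
    then have d'_less: "d' < d" using d'd less.prems(2) dvd_imp_le le_neq_implies_less by blast
    \<comment> \<open>Below \<rho> all exponents of \<gamma> are divisible by \<open>d\<close> and
      their terms are fixed by \<open>w\<close>; the term at \<rho> is the first one moved, since
      \<open>w ^ \<rho> = 1\<close> would put \<open>w\<close> into \<open>roots d'\<close>.\<close>
    have \<delta>_mid: "\<delta> w = \<rho>" if w: "w \<in> roots d - roots d'" for w
    proof -
      have w0: "w \<noteq> 0" using w less.prems(2) roots_nonzero by blast
      have "w powi \<rho> \<noteq> 1"
      proof
        assume "w powi \<rho> = 1"
        moreover have "w powi int d = 1" using w by (simp add: roots_def)
        ultimately have "w powi int d' = 1" unfolding id' using w0 by (intro power_int_gcd_eq_1)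
        then show False using w by (simp add: roots_def)
      qed
      then have "(\<gamma> - twist w \<gamma>) $$ \<rho> \<noteq> 0"
        using \<gamma>\<rho> w0 by (simp add: twist_nth)
      moreover have "ord_ge \<rho> (\<gamma> - twist w \<gamma>)"
        unfolding ord_ge_def
      proof (intro allI impI)
        fix j assume j: "j < \<rho>"
        show "(\<gamma> - twist w \<gamma>) $$ j = 0"
        proof (cases "int d dvd j")
          case True
          then have "w powi j = 1" using w by (intro power_int_dvd_eq_1) (auto simp: roots_def)
          then show ?thesis using w0 by (simp add: twist_nth)
        next
          case False
          have "rest d $$ j = 0" using j by (simp add: \<rho>_def)
          then have "\<gamma> $$ j = 0" using False by (simp add: rest_def truncate_dvd_nth)
          then show ?thesis using w0 by (simp add: twist_nth)
        qed
      qed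
      ultimately show ?thesis unfolding \<delta>_def by (intro subdegree_eqI_ord_ge)
    qed
    have rest': "ord_ge (\<rho> + 1) (rest d')"
      unfolding ord_ge_def
    proof (intro allI impI)
      fix j assume j: "j < \<rho> + 1"
      show "rest d' $$ j = 0"
      proof (cases "int d' dvd j")
        case True
        then show ?thesis by (simp add: rest_def truncate_dvd_nth)
      next
        case False
        then have "\<not> int d dvd j" using d'_dvd(1) dvd_trans by blast
        moreover have "j < \<rho>" using j False d'_dvd(2) by (cases "j = \<rho>") auto
        then have "rest d $$ j = 0" by (simp add: \<rho>_def)
        ultimately show ?thesis using False by (simp add: rest_def truncate_dvd_nth)
      qed
    qed
    have sep': "separated d'"
      unfolding separated_def
    proof
      fix w assume w: "w \<in> \<Omega> - roots d'"
      have "\<delta> w \<le> \<rho>"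
      proof (cases "w \<in> roots d")
        case True
        then show ?thesis using \<delta>_mid w by auto
      next
        case False
        then have "ord_ge (\<delta> w + 1) (rest d)" using less.prems(3) w by (simp add: separated_def)
        then show ?thesis using nz by (simp add: ord_ge_iff_subdegree \<rho>_def)
      qed
      then show "ord_ge (\<delta> w + 1) (rest d')" using rest' ord_ge_mono by fastforce
    qed
    have sub': "roots d' \<subseteq> roots d" using d'd by (rule roots_dvd)
    have split: "(\<Sum>w\<in>\<Omega> - roots d'. \<delta> w) = (\<Sum>w\<in>\<Omega> - roots d. \<delta> w) + (int d - int d') * \<rho>"
    proof -
      have "\<Omega> - roots d' = (\<Omega> - roots d) \<union> (roots d - roots d')" using sub' roots_sub by blast
      then have "(\<Sum>w\<in>\<Omega> - roots d'. \<delta> w) = (\<Sum>w\<in>\<Omega> - roots d. \<delta> w) + (\<Sum>w\<in>roots d - roots d'. \<delta> w)"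
        using finite_\<Omega> finite_roots[OF less.prems(2)]
        by (simp only:) (rule sum.union_disjoint, auto)
      also have "(\<Sum>w\<in>roots d - roots d'. \<delta> w) = (\<Sum>w\<in>roots d - roots d'. \<rho>)"
        using \<delta>_mid by (intro sum.cong) auto
      also have "\<dots> = int (card (roots d - roots d')) * \<rho>" by simp
      also have "int (card (roots d - roots d')) = int d - int d'"
        using sub' finite_roots[OF d'0] card_roots[OF d'0] card_roots[OF less.prems(2)] d'_less
        by (simp add: card_Diff_subset of_nat_diff)
      finally show ?thesis .
    qed
    have IH: "int d' * (\<Sum>w\<in>\<Omega>-{1}. \<delta> w) \<le> (\<Sum>w\<in>\<Omega> - roots d'. \<delta> w)"
      using less.IH[OF d'_less _ d'0 sep'] d'd less.prems(1) dvd_trans by blast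
    have lev: "int d * \<rho> + (\<Sum>w\<in>\<Omega> - roots d. \<delta> w) \<le> 0"
      unfolding \<rho>_def using less.prems d1 nz by (intro level_nonpos)
    define S1 Sd where "S1 = (\<Sum>w\<in>\<Omega>-{1}. \<delta> w)" and "Sd = (\<Sum>w\<in>\<Omega> - roots d. \<delta> w)"
    \<comment> \<open>Multiplying the induction hypothesis by \<open>d\<close> produces
      \<open>d * \<rho>\<close>, which \<open>level_nonpos\<close> bounds by \<open>- Sd\<close>;
      the common factor \<open>d'\<close> is cancelled at the end.\<close>
    have "int d' * (int d * S1) = int d * (int d' * S1)" by simp
    also have "\<dots> \<le> int d * (Sd + (int d - int d') * \<rho>)"
      using IH split by (intro mult_left_mono) (auto simp: S1_def Sd_def)
    also have "\<dots> = int d * Sd + (int d - int d') * (int d * \<rho>)" by (simp add: algebra_simps)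
    also have "\<dots> \<le> int d * Sd + (int d - int d') * (- Sd)"
      using lev d'_less by (intro add_left_mono mult_left_mono) (auto simp: Sd_def)
    also have "\<dots> = int d' * Sd" by (simp add: algebra_simps)
    finally show ?thesis using d'0 by (simp add: S1_def Sd_def)
  qed
qed

lemma degree_dvd: "degree f dvd degree g \<or> degree g dvd degree f"
proof -
  define m where "m = degree g"
  define d where "d = gcd n m"
  have d0: "d > 0" using deg_pos by (simp add: d_def)
  have dn: "d dvd n" and dm: "d dvd m" by (simp_all add: d_def)
  have m: "fls_subdegree \<gamma> = - int m" "\<gamma> $$ (- int m) \<noteq> 0"
  proof -
    have "g \<noteq> 0" using deg_pos by auto
    then show "fls_subdegree \<gamma> = - int m" "\<gamma> $$ (- int m) \<noteq> 0"
      unfolding \<gamma>_def m_def using fls_subdegree_eval_fls[OF sub_\<theta>] subdegree_eval_fls[OF sub_\<theta>] by auto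
  qed
  \<comment> \<open>Outside \<open>roots d\<close> already the leading term of \<gamma> is moved:
    \<open>w ^ m = 1\<close> and \<open>w ^ n = 1\<close> would give
    \<open>w ^ d = 1\<close>.\<close>
  have \<delta>: "\<delta> w = - int m" if w: "w \<in> \<Omega> - roots d" for w
  proof -
    have w0: "w \<noteq> 0" using w \<Omega>_nonzero by blast
    have "w powi (- int m) \<noteq> 1"
    proof
      assume "w powi (- int m) = 1"
      moreover have "w powi int n = 1" using w by (simp add: roots_def)
      ultimately have "w powi (gcd (int n) (- int m)) = 1" using w0 by (intro power_int_gcd_eq_1)
      then show False using w by (simp add: roots_def d_def)
    qed
    then have "(\<gamma> - twist w \<gamma>) $$ (- int m) \<noteq> 0" using m w0 by (simp add: twist_nth)
    moreover have "ord_ge (- int m) (\<gamma> - twist w \<gamma>)"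
      using m(1) w0 ord_ge_subdegree[of \<gamma>] by (intro ord_ge_diff) (auto simp: ord_ge_twist)
    ultimately show ?thesis unfolding \<delta>_def by (intro subdegree_eqI_ord_ge)
  qed
  have "separated d"
    unfolding separated_def
  proof
    fix w assume w: "w \<in> \<Omega> - roots d"
    have "ord_ge (- int m + 1) (rest d)"
      unfolding ord_ge_def
    proof (intro allI impI)
      fix j assume "j < - int m + 1"
      then have "\<gamma> $$ j = 0 \<or> j = - int m" using m(1) by fastforce
      then show "rest d $$ j = 0" using dm by (auto simp: rest_def truncate_dvd_nth)
    qed
    then show "ord_ge (\<delta> w + 1) (rest d)" by (simp add: \<delta>[OF w])
  qed
  then have "int d * (\<Sum>w\<in>\<Omega>-{1}. \<delta> w) \<le> (\<Sum>w\<in>\<Omega> - roots d. \<delta> w)"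
    using dn d0 by (intro sum_\<delta>_le)
  also have "(\<Sum>w\<in>\<Omega> - roots d. \<delta> w) = - ((int n - int d) * int m)"
  proof -
    have "d \<le> n" using dn deg_pos by (simp add: dvd_imp_le)
    then have "int (card (\<Omega> - roots d)) = int n - int d"
      using roots_dvd[OF dn] finite_roots[OF d0] card_roots[OF d0] card_\<Omega>
      by (simp add: card_Diff_subset of_nat_diff)
    then show ?thesis using \<delta> by simp
  qed
  finally have "(int n - int d) * int m \<le> int d * (- (\<Sum>w\<in>\<Omega>-{1}. \<delta> w))" by simp
  also have "\<dots> \<le> int d * (int n - 1)" using sum_\<delta>_ge by (intro mult_left_mono) auto
  finally have ineq: "(int n - int d) * int m \<le> int d * (int n - 1)" .
  obtain n' m' where n'm': "n = d * n'" "m = d * m'" using dn dm by (auto elim!: dvdE)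
  have pos: "n' > 0" "m' > 0" using n'm' deg_pos by (auto simp: m_def intro: Nat.gr0I)
  have "int d * ((int n' - 1) * int m * 1) \<le> int d * (int n - 1)"
    using ineq by (simp add: n'm'(1) algebra_simps)
  then have "(int n' - 1) * int m \<le> int n - 1" using d0 by simp
  then have "int d * ((int n' - 1) * int m') < int d * int n'" by (simp add: n'm' algebra_simps)
  then have less: "(int n' - 1) * int m' < int n'" using d0 by simp
  \<comment> \<open>If both were at least 2, the product on the left would be at least
    \<open>2 * (n' - 1)\<close>, hence at least \<open>n'\<close>.\<close>
  have "n' = 1 \<or> m' = 1"
  proof (rule ccontr)
    assume "\<not> (n' = 1 \<or> m' = 1)"
    then have "n' \<ge> 2" "m' \<ge> 2" using pos by auto
    then have "(int n' - 1) * 2 \<le> (int n' - 1) * int m'" by (intro mult_left_mono) auto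
    then have "(int n' - 1) * 2 < int n'" using less by (rule le_less_trans)
    moreover have "int n' \<ge> 2" using \<open>n' \<ge> 2\<close> by simp
    ultimately show False by (simp add: algebra_simps)
  qed
  then show ?thesis using n'm' by (auto simp: m_def)
qed

end

lemma abhyankar_moh_alg_closed:
  fixes f g :: "'a::{alg_closed_field, field_char_0} poly"
  assumes "degree f > 0" "degree g > 0"
    and "poly (map_poly (\<lambda>c. pcompose c f) p) g = [:0, 1:]"
  shows "degree f dvd degree g \<or> degree g dvd degree f"
proof -
  obtain \<theta> where "fls_subdegree \<theta> = -1" "eval_fls f \<theta> = fls_X_intpow (- int (degree f))"
    using inverse_parametrization[OF refl assms(1)] by blast
  then interpret line_parametrization f g p \<theta> using assms by unfold_locales
  show ?thesis by (rule degree_dvd)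
qed

section \<open>The theorem of Abhyankar and Moh\<close>

lemma ring_map_pcompose: "ring_map (\<lambda>c :: 'a::comm_ring_1 poly. pcompose c a)"
  by unfold_locales (auto simp: pcompose_1 pcompose_add pcompose_mult)

text \<open>The pull-back \<open>p(a(t), b(t))\<close> along a parametrized plane curve.\<close>

definition curve :: "'a::comm_ring_1 poly \<Rightarrow> 'a poly \<Rightarrow> 'a poly poly \<Rightarrow> 'a poly" where
  "curve a b p = poly (map_poly (\<lambda>c. pcompose c a) p) b"

lemma ring_map_curve: "ring_map (curve a b)"
  unfolding curve_def[abs_def] by (intro ring_map.ring_map_poly_map_poly ring_map_pcompose)

text \<open>Base change to the algebraic closure preserves the degrees and the relation
  \<open>p(f, g) = t\<close>.\<close>

lemma abhyankar_moh:
  fixes f g :: "'k::field_char_0 poly"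
  assumes "degree f > 0" "degree g > 0" and p: "curve f g p = [:0, 1:]"
  shows "degree f dvd degree g \<or> degree g dvd degree f"
proof -
  interpret h: ring_map "to_ac :: 'k \<Rightarrow> _" by unfold_locales auto
  interpret H: ring_map "map_poly (to_ac :: 'k \<Rightarrow> _)" by (rule h.ring_map_map_poly)
  let ?f = "map_poly to_ac f" and ?g = "map_poly to_ac g"
  have deg: "degree (map_poly to_ac q) = degree q" for q :: "'k poly"
    by (rule degree_map_poly) simp
  have "map_poly (\<lambda>c. pcompose c ?f) (map_poly (map_poly to_ac) p)
      = map_poly (map_poly to_ac) (map_poly (\<lambda>c. pcompose c f) p)"
    by (rule poly_eqI) (simp add: coeff_map_poly h.map_poly_pcompose)
  then have "poly (map_poly (\<lambda>c. pcompose c ?f) (map_poly (map_poly to_ac) p)) ?g = map_poly to_ac [:0, 1:]"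
    using p by (simp only: H.poly_map_poly curve_def)
  then show ?thesis
    using abhyankar_moh_alg_closed[of ?f ?g "map_poly (map_poly to_ac) p"] assms by (simp add: deg)
qed

section \<open>Plane automorphisms and their action on curves\<close>

lemma alg_hom_ring_map: "alg_hom \<phi> \<Longrightarrow> ring_map \<phi>"
  unfolding alg_hom_def by unfold_locales (metis scalar_simps)+

lemma ring_map_scalar: "ring_map (scalar :: 'k::field \<Rightarrow> _)"
  by unfold_locales (simp_all add: scalar_simps)

lemma curve_gens [simp]: "curve a b (scalar c) = [:c:]" "curve a b var_x = a" "curve a b var_y = b"
  by (simp_all add: curve_def scalar_def var_x_def var_y_def map_poly_pCons pcompose_pCons pcompose_1)

lemma curve_xy_subst: "curve a b (xy_subst s t q) = curve (curve a b s) (curve a b t) q"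
proof -
  interpret c: ring_map "curve a b" by (rule ring_map_curve)
  interpret sc: ring_map "scalar :: 'a \<Rightarrow> _" by (rule ring_map_scalar)
  define H where "H = (\<lambda>c. poly (map_poly scalar c) s)"
  interpret H: ring_map H unfolding H_def by (rule sc.ring_map_poly_map_poly)
  have "curve a b (H e) = pcompose e (curve a b s)" for e
  proof -
    have "map_poly (curve a b) (map_poly scalar e) = map_poly (\<lambda>k. [:k:]) e"
      by (rule poly_eqI) (simp add: coeff_map_poly)
    then show ?thesis
      using c.poly_map_poly[of "map_poly scalar e" s] by (simp only: H_def pcompose_altdef)
  qed
  then have "map_poly (curve a b) (map_poly H q) = map_poly (\<lambda>e. pcompose e (curve a b s)) q"
    by (intro poly_eqI) (simp add: coeff_map_poly)
  then show ?thesis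
    using c.poly_map_poly[of "map_poly H q" t]
    by (simp only: xy_subst_def curve_def[of "curve a b s"] H_def)
qed

lemma alg_hom_compose: "alg_hom \<phi> \<Longrightarrow> alg_hom \<psi> \<Longrightarrow> alg_hom (\<phi> \<circ> \<psi>)"
  by (auto simp: alg_hom_def)

lemma alg_hom_eq_id:
  assumes "alg_hom \<phi>" "\<phi> var_x = var_x" "\<phi> var_y = var_y"
  shows "\<phi> = id"
proof -
  have "alg_hom id" by (simp add: alg_hom_def)
  then show ?thesis using alg_hom_unique[of id var_x var_y] alg_hom_unique[OF assms] by (metis id_apply)
qed

lemma alg_autI:
  assumes "alg_hom \<phi>" "alg_hom \<psi>"
    and "\<phi> (\<psi> var_x) = var_x" "\<phi> (\<psi> var_y) = var_y" "\<psi> (\<phi> var_x) = var_x" "\<psi> (\<phi> var_y) = var_y"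
  shows "alg_aut \<phi>"
proof -
  have "\<phi> \<circ> \<psi> = id" "\<psi> \<circ> \<phi> = id"
    using assms by (auto intro!: alg_hom_eq_id alg_hom_compose)
  then show ?thesis unfolding alg_aut_def using assms(1) o_bij by blast
qed

lemma alg_aut_compose: "alg_aut \<phi> \<Longrightarrow> alg_aut \<psi> \<Longrightarrow> alg_aut (\<phi> \<circ> \<psi>)"
  by (auto simp: alg_aut_def alg_hom_compose bij_comp)

lemma xy_subst_simps [simp]:
  "xy_subst a b (scalar c) = scalar c" "xy_subst a b var_x = a" "xy_subst a b var_y = b"
  "xy_subst a b (f + g) = xy_subst a b f + xy_subst a b g"
  "xy_subst a b (f - g) = xy_subst a b f - xy_subst a b g"
  "xy_subst a b (f * g) = xy_subst a b f * xy_subst a b g"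
  "xy_subst a b (f ^ n) = xy_subst a b f ^ n"
proof -
  interpret ring_map "xy_subst a b" by (intro alg_hom_ring_map alg_hom_xy_subst)
  show "xy_subst a b (scalar c) = scalar c" using alg_hom_xy_subst[of a b] by (simp add: alg_hom_def)
qed (simp_all add: xy_subst_X xy_subst_Y ring_map.map_add ring_map.map_diff ring_map.map_mult ring_map.map_power
      alg_hom_ring_map alg_hom_xy_subst)

lemma alg_aut_swap: "alg_aut (xy_subst var_y var_x :: 'k::field poly poly \<Rightarrow> _)"
  by (rule alg_autI[where \<psi> = "xy_subst var_y var_x"]) (simp_all add: alg_hom_xy_subst)

lemma alg_aut_affine:
  assumes "a1 \<noteq> 0"
  shows "alg_aut (xy_subst (scalar a0 + scalar a1 * var_x) (var_y + scalar b0))"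
proof -
  interpret sc: ring_map "scalar :: 'a \<Rightarrow> _" by (rule ring_map_scalar)
  have inv: "scalar a1 * (scalar (1 / a1) * q) = q" "scalar (1 / a1) * (scalar a1 * q) = q" for q
    using assms by (simp_all flip: mult.assoc sc.map_mult)
  show ?thesis
    by (rule alg_autI[where \<psi> = "xy_subst (scalar (1 / a1) * (var_x - scalar a0)) (var_y - scalar b0)"])
      (simp_all add: alg_hom_xy_subst inv)
qed

lemma alg_aut_triangular: "alg_aut (xy_subst var_x (var_y + scalar c * var_x ^ k))"
  by (rule alg_autI[where \<psi> = "xy_subst var_x (var_y - scalar c * var_x ^ k)"])
    (simp_all add: alg_hom_xy_subst)

section \<open>Straightening an embedded line\<close>

lemma straighten_swap:
  assumes "alg_aut \<psi>" "\<And>q. curve [:0, 1:] 0 (\<psi> q) = curve b a q"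
  shows "\<exists>\<psi>. alg_aut \<psi> \<and> (\<forall>q. curve [:0, 1:] 0 (\<psi> q) = curve a b q)"
proof (intro exI conjI allI)
  show "alg_aut (\<psi> \<circ> xy_subst var_y var_x)" using assms(1) alg_aut_swap by (rule alg_aut_compose)
  show "curve [:0, 1:] 0 ((\<psi> \<circ> xy_subst var_y var_x) q) = curve a b q" for q
    by (simp add: assms(2) curve_xy_subst)
qed

text \<open>On a horizontal line \<open>p(x, \<beta>)\<close> composed with \<open>a\<close> is
  \<open>t\<close>, so degrees force \<open>a\<close> to be affine linear, and an affine
  automorphism does the rest.\<close>

lemma straighten_const:
  fixes a :: "'k::field_char_0 poly"
  assumes p: "curve a [:\<beta>:] p = [:0, 1:]"
  shows "\<exists>\<psi>. alg_aut \<psi> \<and> (\<forall>q. curve [:0, 1:] 0 (\<psi> q) = curve a [:\<beta>:] q)"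
proof -
  interpret r: ring_map "\<lambda>c. pcompose c a" by (rule ring_map_pcompose)
  have "pcompose (poly p [:\<beta>:]) a = [:0, 1:]"
    using r.poly_map_poly[of p "[:\<beta>:]"] p by (simp add: curve_def)
  then have "degree (poly p [:\<beta>:]) * degree a = 1" by (metis degree_pCons_eq_if degree_pcompose one_neq_zero
        degree_1 One_nat_def pCons_eq_0_iff one_pCons)
  then have "degree a = 1" by simp
  then obtain a0 a1 where a: "a = [:a0, a1:]" "a1 \<noteq> 0"
    by (metis degree1_coeffs)
  show ?thesis
  proof (intro exI conjI allI)
    show "alg_aut (xy_subst (scalar a0 + scalar a1 * var_x) (var_y + scalar \<beta>))"
      using a(2) by (rule alg_aut_affine)
    interpret c: ring_map "curve [:0, 1:] 0" by (rule ring_map_curve)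
    show "curve [:0, 1:] 0 (xy_subst (scalar a0 + scalar a1 * var_x) (var_y + scalar \<beta>) q) = curve a [:\<beta>:] q" for q
      by (simp add: curve_xy_subst a(1))
  qed
qed

text \<open>Subtracting a multiple of a power of \<open>a\<close> removes the leading term of
  \<open>b\<close>. A triangular automorphism \<tau> realizes this, and \<open>\<tau> p\<close>
  recovers the parameter on the new curve, so \<open>IH\<close> applies.\<close>

lemma straighten_reduce:
  fixes a b :: "'k::field_char_0 poly"
  assumes deg: "degree a > 0" "degree b > 0" "degree a dvd degree b"
    and p: "curve a b p = [:0, 1:]"
    and IH: "\<And>b' p. degree b' < degree b \<Longrightarrow> curve a b' p = [:0, 1:] \<Longrightarrow>
      \<exists>\<psi>. alg_aut \<psi> \<and> (\<forall>q. curve [:0, 1:] 0 (\<psi> q) = curve a b' q)"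
  shows "\<exists>\<psi>. alg_aut \<psi> \<and> (\<forall>q. curve [:0, 1:] 0 (\<psi> q) = curve a b q)"
proof -
  obtain k where k: "degree b = degree a * k" using deg(3) by (elim dvdE)
  define c where "c = lead_coeff b / lead_coeff a ^ k"
  define b' where "b' = b - smult c (a ^ k)"
  have a0: "a \<noteq> 0" using deg by auto
  have "degree (a ^ k) = degree b" using a0 k by (simp add: degree_power_eq mult.commute)
  moreover have "lead_coeff (a ^ k) = lead_coeff a ^ k" by (rule lead_coeff_power)
  ultimately have "coeff b' (degree b) = 0" using a0 by (simp add: b'_def c_def)
  moreover have "degree b' \<le> degree b"
    unfolding b'_def using \<open>degree (a ^ k) = degree b\<close> by (intro degree_diff_le) (auto intro: order.trans[OF degree_smult_le])
  ultimately have "degree b' < degree b"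
    using deg(2) by (metis degree_0 le_neq_implies_less leading_coeff_0_iff)
  define \<tau> where "\<tau> = (xy_subst var_x (var_y + scalar c * var_x ^ k) :: 'k poly poly \<Rightarrow> _)"
  interpret c: ring_map "curve a b'" by (rule ring_map_curve)
  have \<tau>: "curve a b' (\<tau> q) = curve a b q" for q
  proof -
    have "curve a b' (var_y + scalar c * var_x ^ k) = b' + [:c:] * a ^ k" by simp
    also have "\<dots> = b" by (simp add: b'_def)
    finally show ?thesis by (simp add: \<tau>_def curve_xy_subst)
  qed
  obtain \<psi> where \<psi>: "alg_aut \<psi>" "\<forall>q. curve [:0, 1:] 0 (\<psi> q) = curve a b' q"
    using IH[OF \<open>degree b' < degree b\<close>, of "\<tau> p"] p \<tau> by metis
  have "alg_aut (\<psi> \<circ> \<tau>)" using \<psi>(1) alg_aut_triangular unfolding \<tau>_def by (rule alg_aut_compose)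
  then show ?thesis using \<psi>(2) \<tau> by (intro exI[of _ "\<psi> \<circ> \<tau>"]) simp
qed

text \<open>Abhyankar-Moh makes the degree reduction possible until one coordinate is constant.
  Stating the conclusion for all \<open>q\<close> lets the successive automorphisms be
  composed.\<close>

lemma straighten:
  fixes a b :: "'k::field_char_0 poly"
  assumes "curve a b p = [:0, 1:]"
  shows "\<exists>\<psi>. alg_aut \<psi> \<and> (\<forall>q. curve [:0, 1:] 0 (\<psi> q) = curve a b q)"
  using assms
proof (induction "degree a + degree b" arbitrary: a b p rule: less_induct)
  case less
  have swap: "curve b a (xy_subst var_y var_x p) = [:0, 1:]"
    using less.prems by (simp add: curve_xy_subst)
  consider "degree b = 0" | "degree a = 0" | "degree a > 0" "degree b > 0" "degree a dvd degree b"
    | "degree a > 0" "degree b > 0" "degree b dvd degree a"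
    using abhyankar_moh[OF _ _ less.prems] by blast
  then show ?case
  proof cases
    case 1
    then obtain \<beta> where "b = [:\<beta>:]" by (metis degree_0_id)
    then show ?thesis using straighten_const[of a \<beta>] less.prems by simp
  next
    case 2
    then obtain \<beta> where "a = [:\<beta>:]" by (metis degree_0_id)
    then obtain \<psi> where "alg_aut \<psi>" "\<And>q. curve [:0, 1:] 0 (\<psi> q) = curve b a q"
      using straighten_const[of b \<beta>] swap by auto
    then show ?thesis by (rule straighten_swap)
  next
    case 3
    then show ?thesis using less.prems by (rule straighten_reduce) (rule less.hyps, auto)
  next
    case 4
    have "\<exists>\<psi>. alg_aut \<psi> \<and> (\<forall>q. curve [:0, 1:] 0 (\<psi> q) = curve b a q)"
      using 4(2,1,3) swap by (rule straighten_reduce) (rule less.hyps, auto)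
    then obtain \<psi> where "alg_aut \<psi>" "\<And>q. curve [:0, 1:] 0 (\<psi> q) = curve b a q" by auto
    then show ?thesis by (rule straighten_swap)
  qed
qed

section \<open>Retracts\<close>

lemma poly_scalar_in_subalgebra:
  assumes "kxy_subalgebra R" "p \<in> R"
  shows "poly (map_poly scalar c) p \<in> R"
proof (induction c)
  case 0
  have "scalar 0 \<in> R" using assms by (simp add: kxy_subalgebra_def)
  then show ?case by (simp add: scalar_simps)
next
  case (pCons a c)
  then show ?case
    using assms by (simp add: poly_map_poly_pCons scalar_simps kxy_subalgebra_def)
qed

lemma gen_alg_eq: "gen_alg p = range (\<lambda>c. poly (map_poly scalar c) p)"
proof
  interpret sc: ring_map "scalar :: 'a \<Rightarrow> _" by (rule ring_map_scalar)
  interpret e: ring_map "\<lambda>c. poly (map_poly scalar c) p" by (rule sc.ring_map_poly_map_poly)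
  let ?R = "range (\<lambda>c. poly (map_poly scalar c) p)"
  have "scalar c \<in> ?R" for c by (intro range_eqI[of _ _ "[:c:]"]) simp
  moreover have "x + y \<in> ?R" "x * y \<in> ?R" if "x \<in> ?R" "y \<in> ?R" for x y
  proof -
    from that obtain c d where "x = poly (map_poly scalar c) p" "y = poly (map_poly scalar d) p" by blast
    then show "x + y \<in> ?R" "x * y \<in> ?R" by (metis e.map_add rangeI, metis e.map_mult rangeI)
  qed
  ultimately have "kxy_subalgebra ?R" unfolding kxy_subalgebra_def by blast
  moreover have "p \<in> ?R" by (intro range_eqI[of _ _ "[:0, 1:]"]) simp
  ultimately show "gen_alg p \<subseteq> ?R" unfolding gen_alg_def by (intro hull_minimal) auto
  show "?R \<subseteq> gen_alg p"
  proof
    fix q assume "q \<in> ?R"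
    then obtain c where c: "q = poly (map_poly scalar c) p" by blast
    show "q \<in> gen_alg p"
      unfolding gen_alg_def hull_def c
    proof (rule InterI)
      fix R assume "R \<in> {t. kxy_subalgebra t \<and> {p} \<subseteq> t}"
      then show "poly (map_poly scalar c) p \<in> R" by (intro poly_scalar_in_subalgebra) auto
    qed
  qed
qed

text \<open>A non-constant \<open>p\<close> is transcendental over \<open>K\<close>: composition
  with a polynomial of positive degree kills no nonzero polynomial. This is applied in
  \<open>y\<close>, or in \<open>x\<close> when \<open>p\<close> is free of
  \<open>y\<close>.\<close>

lemma scalar_poly_eq_0:
  fixes p :: "'k::field poly poly"
  assumes nonconst: "\<And>c. p \<noteq> scalar c" and "poly (map_poly scalar w) p = 0"
  shows "w = 0"
proof (rule ccontr)
  assume w: "w \<noteq> 0"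
  define W where "W = map_poly (\<lambda>k::'k. [:k:]) w"
  have dW: "degree W = degree w" unfolding W_def by (rule degree_map_poly) simp
  have "map_poly scalar w = map_poly (\<lambda>k. [:k:]) W"
    unfolding W_def by (rule poly_eqI) (simp add: coeff_map_poly scalar_def)
  then have 0: "pcompose W p = 0" using assms(2) by (simp add: pcompose_altdef)
  have "degree p = 0"
  proof (rule ccontr)
    assume "degree p \<noteq> 0"
    then have "W = 0" using 0 pcompose_eq_0 by blast
    then show False using w by (metis W_def coeff_0 coeff_map_poly pCons_0_0 pCons_eq_0_iff poly_eqI)
  qed
  then obtain c where c: "p = [:c:]" by (metis degree_0_id)
  have "pcompose w c = 0" using 0 by (simp add: c pcompose_pCons_0 W_def flip: pcompose_altdef)
  have "degree c \<noteq> 0"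
  proof
    assume "degree c = 0"
    then obtain k where "c = [:k:]" by (metis degree_0_id)
    then show False using nonconst[of k] c by (simp add: scalar_def)
  qed
  then show False using \<open>pcompose w c = 0\<close> w pcompose_eq_0 by blast
qed

text \<open>The retraction sends \<open>x\<close> and \<open>y\<close> to some \<open>a(p)\<close>
  and \<open>b(p)\<close> and fixes \<open>p\<close>, so \<open>p(a(t), b(t)) - t\<close> vanishes
  at \<open>t = p\<close>; transcendence of \<open>p\<close> makes it zero.\<close>

lemma retract_section:
  fixes p :: "'k::field poly poly"
  assumes nonconst: "\<And>c. p \<noteq> scalar c" and retr: "kxy_retract (gen_alg p)"
  shows "\<exists>a b. curve a b p = [:0, 1:]"
proof -
  obtain \<phi> where \<phi>: "alg_hom \<phi>" "\<phi> \<circ> \<phi> = \<phi>" "range \<phi> = gen_alg p"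
    using retr by (auto simp: kxy_retract_def kxy_retraction_def)
  define ev where "ev = (\<lambda>c. poly (map_poly scalar c) p)"
  interpret sc: ring_map "scalar :: 'k \<Rightarrow> _" by (rule ring_map_scalar)
  interpret ev: ring_map ev unfolding ev_def by (rule sc.ring_map_poly_map_poly)
  have ev_const: "ev [:k:] = scalar k" for k by (simp add: ev_def)
  have ran: "range \<phi> = range ev" using \<phi>(3) by (simp add: gen_alg_eq ev_def)
  then obtain a b where ab: "\<phi> var_x = ev a" "\<phi> var_y = ev b" by (metis rangeI imageE)
  have p_ev: "p = ev [:0, 1:]" by (simp add: ev_def)
  then obtain q where "p = \<phi> q" using ran by (metis rangeI imageE)
  then have "\<phi> p = p" using \<phi>(2) by (metis comp_apply)
  have "alg_hom (\<lambda>q. ev (curve a b q))"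
  proof -
    interpret c: ring_map "curve a b" by (rule ring_map_curve)
    show ?thesis by (simp add: alg_hom_def ev_const)
  qed
  then have "(\<lambda>q. ev (curve a b q)) = \<phi>"
    using alg_hom_unique[of _ "ev a" "ev b"] \<phi>(1) ab by (metis curve_gens(2,3))
  then have "ev (curve a b p - [:0, 1:]) = 0"
    using \<open>\<phi> p = p\<close> p_ev by (metis ev.map_diff diff_self)
  then have "curve a b p - [:0, 1:] = 0"
    unfolding ev_def by (rule scalar_poly_eq_0[OF nonconst])
  then show ?thesis by auto
qed

text \<open>The map sends \<open>f\<close> to \<open>f(P, 0)\<close>, and \<open>f(x, 0)\<close>
  ranges over all of \<open>K[x]\<close>. It fixes \<open>P\<close>, since it sends \<open>x\<close>
  to \<open>P\<close> and kills the multiple of \<open>y\<close>; idempotence is then checked on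
  generators.\<close>

lemma kxy_retraction_x_axis:
  fixes q :: "'k::field poly poly"
  defines "P \<equiv> var_x + var_y * q"
  shows "kxy_retraction (xy_subst P 0) (gen_alg P)"
  unfolding kxy_retraction_def
proof (intro conjI)
  let ?\<chi> = "xy_subst P 0"
  show hom: "alg_hom ?\<chi>" by (rule alg_hom_xy_subst)
  interpret \<chi>: ring_map ?\<chi> by (intro alg_hom_ring_map hom)
  have fixP: "?\<chi> P = P" unfolding P_def by simp
  have "?\<chi> \<circ> ?\<chi> = xy_subst P 0"
    by (rule alg_hom_unique) (simp_all add: alg_hom_compose hom fixP)
  then show "?\<chi> \<circ> ?\<chi> = ?\<chi>" .
  have eq: "?\<chi> f = poly (map_poly scalar (coeff f 0)) P" for f
    by (simp add: xy_subst_def poly_0_coeff_0 coeff_map_poly)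
  show "range ?\<chi> = gen_alg P"
  proof
    show "range ?\<chi> \<subseteq> gen_alg P" unfolding gen_alg_eq eq by blast
    show "gen_alg P \<subseteq> range ?\<chi>"
      unfolding gen_alg_eq
    proof (intro image_subsetI)
      fix c :: "'k poly"
      show "poly (map_poly scalar c) P \<in> range ?\<chi>"
        using eq[of "[:c:]"] by (metis coeff_pCons_0 rangeI)
    qed
  qed
qed

theorem theorem1p1:
  fixes p :: "'k::field_char_0 poly poly"
  assumes nonconst: "\<And>c. p \<noteq> scalar c"
    and retr: "kxy_retract (gen_alg p)"
  shows "\<exists>\<psi> q. alg_aut \<psi> \<and> \<psi> p = var_x + var_y * q \<and>
           kxy_retraction (xy_subst (var_x + var_y * q) 0) (gen_alg (\<psi> p))"
proof -
  obtain a b where ab: "curve a b p = [:0, 1:]" using retract_section[OF assms] by blast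
  obtain \<psi> where \<psi>: "alg_aut \<psi>" "curve [:0, 1:] 0 (\<psi> p) = [:0, 1:]"
    using straighten[OF ab] ab by auto
  obtain c q where cq: "\<psi> p = pCons c q" by (rule pCons_cases)
  \<comment> \<open>The coefficient \<open>c\<close> is the restriction of \<open>\<psi> p\<close>
    to the line \<open>y = 0\<close>, on which \<open>\<psi> p\<close> equals the parameter.\<close>
  have "c = [:0, 1:]" using \<psi>(2) by (simp add: curve_def cq map_poly_pCons)
  then have eq: "\<psi> p = var_x + var_y * q" by (simp add: cq var_x_def var_y_def)
  show ?thesis using \<psi>(1) eq kxy_retraction_x_axis[of q] by (intro exI[of _ \<psi>] exI[of _ q]) simp
qed

end
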